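(* Let $\beta>1$ be a real number. (i) If $\log\beta>\pi^2/(6\log2)$, then there exist two constants $B_1>0$ and $\gamma_1>0$ (both depending only on $\beta$) such that for all $n\ge1$, \[ \lambda\left\{x\in[0,1):\left|x-\frac{p_n(x)}{q_n(x)}\right|\le x-x_n\right\}\le B_1e^{-\gamma_1 n}. \] (ii) If $\log\beta<\pi^2/(6\log2)$, then there exist two constants $B_2>0$ and $\gamma_2>0$ (both depending only on $\beta$) such that for all $n\ge1$, \[ \lambda\left\{x\in[0,1): x-x_n\le\left|x-\frac{p_n(x)}{q_n(x)}\right|\right\}\le B_2e^{-\gamma_2 n}. \]
   Context: $\lambda$ is Lebesgue measure on $[0,1)$, $\log$ is the natural logarithm, and $[y]$ denotes the greatest integer not exceeding $y$. $\beta$-expansion: for real $\beta>1$ let $T_\beta:[0,1)\to[0,1)$, $T_\beta(x)=\beta x-[\beta x]$. The digits of $x\in[0,1)$ are $\varepsilon_1(x)=[\beta x]$ and $\varepsilon_{n+1}(x)=\varepsilon_1(T_\beta^n x)$ for $n\ge1$. The $n$-th convergent of the $\beta$-expansion of $x$ is $x_n=\sum_{i=1}^n\varepsilon_i(x)\beta^{-i}$. Continued fractions: let $T(0)=0$ and $T(x)=1/x-[1/x]$ for $x\in(0,1)$ (Gauss transformation). The partial quotients of an irrational $x\in[0,1)$ are $a_1(x)=[1/x]$, $a_{n+1}(x)=a_1(T^nx)$. The $n$-th convergent of its continued fraction is \[ \frac{p_n(x)}{q_n(x)}=[a_1(x),\dots,a_n(x)]=\cfrac{1}{a_1(x)+\cfrac{1}{a_2(x)+\cdots+\cfrac{1}{a_n(x)}}},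 \] with $p_n(x),q_n(x)$ relatively prime positive integers. Since these are considered for irrational $x$, the sets in the claim are understood as sets of irrational $x$ (rationals have Lebesgue measure zero). *)

theory Defs
  imports "HOL-Analysis.Analysis"
begin

definition beta_map :: "real \<Rightarrow> real \<Rightarrow> real" where
  "beta_map \<beta> x = \<beta> * x - of_int \<lfloor>\<beta> * x\<rfloor>"

(* Digits and partial quotients are numbered from 1; the index 0 is never used. *)
definition beta_digit :: "real \<Rightarrow> nat \<Rightarrow> real \<Rightarrow> int" where
  "beta_digit \<beta> n x = \<lfloor>\<beta> * (beta_map \<beta> ^^ (n - 1)) x\<rfloor>"

definition beta_convergent :: "real \<Rightarrow> nat \<Rightarrow> real \<Rightarrow> real" where
  "beta_convergent \<beta> n x = (\<Sum>i=1..n. of_int (beta_digit \<beta> i x) / \<beta> ^ i)"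

definition gauss_map :: "real \<Rightarrow> real" where
  "gauss_map x = (if x = 0 then 0 else 1 / x - of_int \<lfloor>1 / x\<rfloor>)"

definition partial_quotient :: "nat \<Rightarrow> real \<Rightarrow> int" where
  "partial_quotient n x = \<lfloor>1 / (gauss_map ^^ (n - 1)) x\<rfloor>"

fun finite_cf :: "int list \<Rightarrow> rat" where
  "finite_cf [] = 0"
| "finite_cf (a # as) = 1 / (of_int a + finite_cf as)"

definition cf_value :: "nat \<Rightarrow> real \<Rightarrow> rat" where
  "cf_value n x = finite_cf (map (\<lambda>i. partial_quotient i x) [1..<Suc n])"

(* quotient_of returns the representation in lowest terms with positive denominator *)
definition cf_num :: "nat \<Rightarrow> real \<Rightarrow> int" where
  "cf_num n x = fst (quotient_of (cf_value n x))"

definition cf_denom :: "nat \<Rightarrow> real \<Rightarrow> int" where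
  "cf_denom n x = snd (quotient_of (cf_value n x))"

lemma coprime_cf_num_denom: "coprime (cf_num n x) (cf_denom n x)"
  unfolding cf_num_def cf_denom_def by (rule quotient_of_coprime) simp

lemma cf_denom_pos: "cf_denom n x > 0"
  unfolding cf_denom_def by (rule quotient_of_denom_pos')

lemma cf_num_over_denom:
  "real_of_int (cf_num n x) / real_of_int (cf_denom n x) = of_rat (cf_value n x)"
proof -
  have "cf_value n x = of_int (cf_num n x) / of_int (cf_denom n x)"
    unfolding cf_num_def cf_denom_def by (rule quotient_of_div) simp
  then show ?thesis by (simp add: of_rat_divide)
qed

lemma gauss_iterate:
  assumes "0 < x" "x < 1" "x \<notin> \<rat>"
  shows "0 < (gauss_map ^^ k) x \<and> (gauss_map ^^ k) x < 1 \<and> (gauss_map ^^ k) x \<notin> \<rat>"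
proof (induction k)
  case 0
  then show ?case using assms by simp
next
  case (Suc k)
  define y where "y = (gauss_map ^^ k) x"
  have y: "0 < y" "y < 1" "y \<notin> \<rat>" using Suc by (auto simp: y_def)
  have inv: "1 / y \<notin> \<rat>"
  proof
    assume "1 / y \<in> \<rat>"
    then have "1 / (1 / y) \<in> \<rat>" by (rule Rats_divide[OF Rats_1])
    then show False using y by simp
  qed
  have irr: "frac (1 / y) \<notin> \<rat>"
  proof
    assume "frac (1 / y) \<in> \<rat>"
    then have "frac (1 / y) + of_int \<lfloor>1 / y\<rfloor> \<in> \<rat>" by (rule Rats_add) simp
    then show False using inv by (simp add: frac_def)
  qed
  then have "frac (1 / y) \<noteq> 0" by (metis Rats_0)
  then have "0 < frac (1 / y)" using frac_ge_0[of "1 / y"] by linarith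
  moreover have "gauss_map y = frac (1 / y)" using y by (simp add: gauss_map_def frac_def)
  ultimately show ?case using irr frac_lt_1[of "1 / y"] by (simp add: y_def)
qed

lemma partial_quotient_pos:
  assumes "0 < x" "x < 1" "x \<notin> \<rat>"
  shows "partial_quotient n x \<ge> 1"
  using gauss_iterate[OF assms, of "n - 1"]
  unfolding partial_quotient_def by (simp add: le_floor_iff)

lemma finite_cf_pos:
  assumes "\<forall>a\<in>set as. a \<ge> 1" "as \<noteq> []"
  shows "finite_cf as > 0"
  using assms
proof (induction as)
  case (Cons a as)
  have "finite_cf as \<ge> 0" using Cons by (cases "as = []") (auto intro: less_imp_le)
  moreover have "(of_int a :: rat) > 0" using Cons.prems by simp
  ultimately show ?case by simp
qed simp

lemma cf_num_pos:
  assumes "0 < x" "x < 1" "x \<notin> \<rat>" "n \<ge> 1"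
  shows "cf_num n x > 0"
proof -
  have "cf_value n x > 0" unfolding cf_value_def
    by (rule finite_cf_pos) (use partial_quotient_pos[OF assms(1-3)] assms(4) in auto)
  then have "0 < real_of_int (cf_num n x) / real_of_int (cf_denom n x)"
    by (simp add: cf_num_over_denom)
  then show ?thesis using cf_denom_pos[of n x] by (simp add: zero_less_divide_iff)
qed

end

theory Submission
  imports Defs
begin

text \<open>
  Under Lebesgue measure the ratios \<open>s\<^sub>n = q\<^sub>n\<^sub>-\<^sub>1 / q\<^sub>n\<close> form a Markov chain that moves from \<open>s\<close> to
  \<open>1 / (k + s)\<close> with probability \<open>(1 + s) / ((k + s) (k + 1 + s))\<close>, and \<open>q\<^sub>n = 1 / (s\<^sub>1 \<cdots> s\<^sub>n)\<close>.
  The transition operator contracts Lipschitz constants and preserves the Gauss measure, so the mean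
  of \<open>- ln s\<^sub>n\<close> converges uniformly in the starting point to \<open>\<pi>\<^sup>2 / (12 ln 2)\<close>. Correcting
  \<open>- ln s\<close> by an approximate solution of the coboundary equation makes its conditional mean almost constant,
  so exponential moments of small positive and negative order give both large deviation bounds
  for \<open>ln \<bar>x - p\<^sub>n / q\<^sub>n\<bar>\<close> around \<open>- n \<pi>\<^sup>2 / (6 ln 2)\<close>.
  On the other side, \<open>x - x\<^sub>n = \<beta>\<^sup>-\<^sup>n T\<^sub>\<beta>\<^sup>n x\<close>, and \<open>T\<^sub>\<beta>\<^sup>n x < \<delta>\<close> has probability at most \<open>\<delta> \<beta> / (\<beta> - 1)\<close>.
\<close>

section \<open>The transition operator\<close>

text \<open>The recursion starts from an arbitrary ratio \<open>s\<close> and splits off the first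
  partial quotient. Conditioning then becomes a plain change of variables, and Lebesgue measure is
  the case \<open>s = 0\<close>. The error itself is followed exactly along the recursion, not
  estimated through denominators, so one moment bound with a parameter \<open>t\<close> of either
  sign yields both tails. Two obstacles shape the estimates. The observable \<open>- ln s\<close> is
  unbounded near 0, hence not Lipschitz; one application of the operator makes it so, and the
  iteration starts from there. And the weights decay like \<open>k^-2\<close> while
  \<open>s^-t\<close> grows like \<open>k^t\<close>, so only small \<open>t\<close> are admissible;
  \<open>|t| <= 1/4\<close> keeps the sums below a multiple of the series of
  \<open>k^(-3/2)\<close>. A one-step bound can be multiplied \<open>n\<close> times only if it
  holds for every \<open>s\<close>. The coboundary supplies this uniformity: the one-step mean is
  right up to \<epsilon>, and the remainder of the exponential costs only a multiple of
  \<open>t^2\<close>. Choosing \<epsilon>, then \<open>t\<close>, small keeps both losses below the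
  gap to the threshold.\<close>

text \<open>Branches are numbered from 0: the partial quotient belonging to \<open>k\<close> is \<open>k + 1\<close>.\<close>

definition gauss_weight :: "real \<Rightarrow> nat \<Rightarrow> real" where
  "gauss_weight s k = (1 + s) / ((real k + 1 + s) * (real k + 2 + s))"

definition gauss_branch :: "nat \<Rightarrow> real \<Rightarrow> real" where
  "gauss_branch k s = 1 / (real k + 1 + s)"

definition gauss_op :: "(real \<Rightarrow> real) \<Rightarrow> real \<Rightarrow> real" where
  "gauss_op f s = (\<Sum>k. gauss_weight s k * f (gauss_branch k s))"

lemma gauss_branch_bounds:
  assumes "s \<ge> 0"
  shows "gauss_branch k s \<in> {0..1}" "0 < gauss_branch k s"
  using assms by (auto simp: gauss_branch_def)

lemma gauss_weight_pos: "s \<ge> 0 \<Longrightarrow> gauss_weight s k > 0"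
  by (auto simp: gauss_weight_def intro!: divide_pos_pos mult_pos_pos)

lemma gauss_weight_nonneg: "s \<ge> 0 \<Longrightarrow> gauss_weight s k \<ge> 0"
  using gauss_weight_pos less_imp_le by blast

text \<open>\<open>k / (k + 1 + s)\<close> is the total weight of the branches before
  \<open>k\<close>; it tends to 1, whence the sum of all weights.\<close>

lemma gauss_weight_eq_diff:
  assumes "s \<ge> 0"
  shows "gauss_weight s k = real (Suc k) / (real (Suc k) + 1 + s) - real k / (real k + 1 + s)"
proof -
  have "real k + 1 + s \<noteq> 0" "real k + 2 + s \<noteq> 0" using assms by auto
  then show ?thesis by (simp add: gauss_weight_def field_simps)
qed

lemma gauss_weight_sums:
  assumes "s \<ge> 0"
  shows "gauss_weight s sums 1"
proof -
  have "(\<lambda>n. real n / (real n + (1 + s))) \<longlonglongrightarrow> 1"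
  proof -
    have "(\<lambda>n. 1 - (1 + s) * inverse ((1 + s) + real n)) \<longlonglongrightarrow> 1 - (1 + s) * 0"
      by (intro tendsto_intros tendsto_inverse_0_at_top filterlim_tendsto_add_at_top[OF tendsto_const]
            filterlim_real_sequentially)
    moreover have "1 - (1 + s) * inverse ((1 + s) + real n) = real n / (real n + (1 + s))" for n
      using assms by (simp add: field_simps)
    ultimately show ?thesis by simp
  qed
  from telescope_sums[OF this] have "(\<lambda>n. real (Suc n) / (real (Suc n) + (1 + s)) - real n / (real n + (1 + s))) sums (1 - 0)"
    by simp
  moreover have "gauss_weight s = (\<lambda>n. real (Suc n) / (real (Suc n) + (1 + s)) - real n / (real n + (1 + s)))"
    using gauss_weight_eq_diff[OF assms] by (simp add: fun_eq_iff add.assoc)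
  ultimately show ?thesis by simp
qed

lemma inverse_squares_summable: "summable (\<lambda>k. 1 / (real k + 1)\<^sup>2)"
  using inverse_squares_sums by (simp add: sums_iff add.commute)

lemma gauss_weight_le:
  assumes "s \<in> {0..1}"
  shows "gauss_weight s k \<le> 2 / (real k + 1)\<^sup>2"
  unfolding gauss_weight_def power2_eq_square
  using assms by (intro frac_le mult_mono) auto

lemma gauss_weight_summable:
  assumes s: "s \<in> {0..1}" and f: "\<And>x. x \<in> {0..1} \<Longrightarrow> \<bar>f x\<bar> \<le> B"
  shows "summable (\<lambda>k. gauss_weight s k * f (gauss_branch k s))"
proof (rule summable_comparison_test')
  have "s \<ge> 0" using s by simp
  show "summable (\<lambda>k. gauss_weight s k * B)"
    using gauss_weight_sums[OF \<open>s \<ge> 0\<close>] by (intro summable_mult2) (simp add: sums_iff)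
  show "norm (gauss_weight s k * f (gauss_branch k s)) \<le> gauss_weight s k * B" if "k \<ge> 0" for k
    using gauss_weight_nonneg[OF \<open>s \<ge> 0\<close>, of k] f[OF gauss_branch_bounds(1)[OF \<open>s \<ge> 0\<close>]]
    by (auto simp: abs_mult intro!: mult_left_mono)
qed

lemma lipschitz_on_unit_bounded:
  fixes f :: "real \<Rightarrow> real"
  assumes "c-lipschitz_on {0..1} f" shows "\<exists>B. \<forall>x\<in>{0..1}. \<bar>f x\<bar> \<le> B"
proof (intro exI ballI)
  fix x :: real assume x: "x \<in> {0..1}"
  have "\<bar>f x - f 0\<bar> \<le> c * \<bar>x - 0\<bar>"
    using lipschitz_onD[OF assms x, of 0] by (simp add: dist_real_def)
  also have "c * \<bar>x - 0\<bar> \<le> \<bar>c\<bar> * 1" using x by (intro mult_mono) auto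
  finally show "\<bar>f x\<bar> \<le> \<bar>f 0\<bar> + \<bar>c\<bar>" by linarith
qed

lemma lipschitz_gauss_summable:
  fixes f :: "real \<Rightarrow> real"
  assumes "c-lipschitz_on {0..1} f" "s \<in> {0..1}"
  shows "summable (\<lambda>k. gauss_weight s k * f (gauss_branch k s))"
  using lipschitz_on_unit_bounded[OF assms(1)] gauss_weight_summable[OF assms(2)] by metis

section \<open>Dependence on the starting point and contraction of Lipschitz constants\<close>

lemma gauss_branch_diff:
  assumes "s \<ge> 0" "t \<ge> 0"
  shows "\<bar>gauss_branch k s - gauss_branch k t\<bar> \<le> \<bar>s - t\<bar> / (real k + 1)\<^sup>2"
proof -
  have p: "real k + 1 + s > 0" "real k + 1 + t > 0" using assms by auto
  have "gauss_branch k s - gauss_branch k t = (t - s) / ((real k + 1 + s) * (real k + 1 + t))"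
    using p unfolding gauss_branch_def by (simp add: diff_frac_eq)
  then have "\<bar>gauss_branch k s - gauss_branch k t\<bar> = \<bar>s - t\<bar> / ((real k + 1 + s) * (real k + 1 + t))"
    using p by (simp add: abs_mult abs_minus_commute)
  also have "\<dots> \<le> \<bar>s - t\<bar> / (real k + 1)\<^sup>2"
    unfolding power2_eq_square using assms by (intro divide_left_mono mult_mono mult_pos_pos) auto
  finally show ?thesis .
qed

lemma gauss_weight_diff:
  assumes "s \<ge> 0" "t \<ge> 0"
  shows "gauss_weight s k - gauss_weight t k = (s - t) * ((real k + 1)\<^sup>2 - (real k + 1) - 1 - (s + t) - s * t)
    / ((real k + 1 + s) * (real k + 1 + t) * (real k + 2 + s) * (real k + 2 + t))"
proof -
  have p: "real k + 1 + s \<noteq> 0" "real k + 1 + t \<noteq> 0" "real k + 2 + s \<noteq> 0" "real k + 2 + t \<noteq> 0" using assms by auto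
  show ?thesis unfolding gauss_weight_def using p
    by (simp add: divide_simps) (simp add: algebra_simps power2_eq_square)
qed

text \<open>At \<open>k = 0\<close> the numerator in \<open>gauss_weight_diff\<close> is
  \<open>- (1 + s) (1 + t)\<close> and cancels. This branch stands apart because the numerator bound
  \<open>r (r - 1)\<close> of the other branches, with \<open>r\<close> one more than the branch
  number, vanishes here.\<close>

lemma gauss_weight_diff_0:
  assumes "s \<in> {0..1}" "t \<in> {0..1}"
  shows "\<bar>gauss_weight s 0 - gauss_weight t 0\<bar> \<le> \<bar>s - t\<bar> / 4"
proof -
  have p: "1 + s > 0" "1 + t > 0" "2 + s > 0" "2 + t > 0" using assms by auto
  have "gauss_weight s 0 - gauss_weight t 0 = (t - s) / ((2 + s) * (2 + t))"
    using p unfolding gauss_weight_def by (simp add: divide_simps)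
  then have "\<bar>gauss_weight s 0 - gauss_weight t 0\<bar> = \<bar>s - t\<bar> / ((2 + s) * (2 + t))"
    using p by (simp add: abs_mult abs_minus_commute)
  also have "\<dots> \<le> \<bar>s - t\<bar> / (2 * 2)"
    using assms by (intro divide_left_mono mult_mono mult_pos_pos) auto
  finally show ?thesis by simp
qed

text \<open>The bound is shaped for summation: it will be multiplied by the value of branch
  \<open>Suc k\<close>, which is at most \<open>1 / (k + 2)\<close>, and such triple products
  telescope.\<close>

lemma gauss_weight_diff_Suc:
  assumes "s \<in> {0..1}" "t \<in> {0..1}"
  shows "\<bar>gauss_weight s (Suc k) - gauss_weight t (Suc k)\<bar> \<le> \<bar>s - t\<bar> * (1 / ((real k + 3) * (real k + 4)))"
proof -
  define r where "r = real k + 2"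
  have r: "r \<ge> 2" by (simp add: r_def)
  have st: "0 \<le> s * t" "s * t \<le> 1" using assms mult_mono[of s 1 t 1] by auto
  \<comment> \<open>The numerator can be negative at \<open>r = 2\<close>. Its lower bound amounts
    to \<open>1 + s + t + s * t <= 2 * (r^2 - r)\<close>, and the left side is at most 4.\<close>
  have "4 \<le> 2 * (r\<^sup>2 - r)" using mult_mono[of 2 r 1 "r - 1"] r by (simp add: power2_eq_square algebra_simps)
  then have num: "\<bar>r\<^sup>2 - r - 1 - (s + t) - s * t\<bar> \<le> r * (r - 1)"
    using assms st unfolding abs_le_iff by (simp add: power2_eq_square algebra_simps)
  have "\<bar>gauss_weight s (Suc k) - gauss_weight t (Suc k)\<bar> =
     \<bar>s - t\<bar> * \<bar>r\<^sup>2 - r - 1 - (s + t) - s * t\<bar> / ((r + s) * (r + t) * (r + 1 + s) * (r + 1 + t))"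
    using gauss_weight_diff[of s t "Suc k"] assms r
    by (simp add: r_def abs_mult add.commute add.left_commute)
  also have "\<dots> \<le> \<bar>s - t\<bar> * (r * (r - 1)) / (r * r * (r + 1) * (r + 1))"
    using num assms r by (intro frac_le mult_left_mono mult_mono) auto
  also have "\<dots> = \<bar>s - t\<bar> * ((r - 1) / (r * (r + 1) * (r + 1)))"
    using r by (simp add: divide_simps)
  also have "\<dots> \<le> \<bar>s - t\<bar> * (1 / ((r + 1) * (r + 2)))"
  proof (rule mult_left_mono)
    show "(r - 1) / (r * (r + 1) * (r + 1)) \<le> 1 / ((r + 1) * (r + 2))"
      using r by (simp add: divide_simps) (simp add: algebra_simps)
  qed simp
  finally show ?thesis by (simp add: r_def add.commute)
qed

text \<open>A cruder bound for all branches at once, matched to \<open>square_root_tail\<close> for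
  use with the logarithm.\<close>

lemma gauss_weight_diff_le:
  assumes "s \<in> {0..1}" "t \<in> {0..1}"
  shows "\<bar>gauss_weight s k - gauss_weight t k\<bar> \<le> \<bar>s - t\<bar> * (1 / (real k + 1)\<^sup>2)"
proof (cases k)
  case 0
  note gauss_weight_diff_0[OF assms]
  also have "\<bar>s - t\<bar> / 4 \<le> \<bar>s - t\<bar>" by simp
  finally show ?thesis by (simp add: 0)
next
  case (Suc j)
  have "\<bar>gauss_weight s k - gauss_weight t k\<bar> \<le> \<bar>s - t\<bar> * (1 / ((real j + 3) * (real j + 4)))"
    unfolding Suc by (rule gauss_weight_diff_Suc[OF assms])
  also have "\<dots> \<le> \<bar>s - t\<bar> * (1 / ((real j + 2) * (real j + 2)))"
    by (intro mult_left_mono divide_left_mono mult_mono) auto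
  also have "(real j + 2) * (real j + 2) = (real k + 1)\<^sup>2"
    using Suc by (simp add: power2_eq_square add.commute)
  finally show ?thesis .
qed

lemma filterlim_add_real_nat: "filterlim (\<lambda>k. real k + c) at_top sequentially"
  using filterlim_tendsto_add_at_top[OF tendsto_const filterlim_real_sequentially, of c]
  by (simp add: add.commute)

text \<open>The terms are the successive differences of \<open>1 / (2 (k + 2) (k + 3))\<close>,
  whose first value is 1/12.\<close>

lemma triple_product_sums: "(\<lambda>k. 1 / ((real k + 2) * (real k + 3) * (real k + 4))) sums (1 / 12)"
proof -
  have "(\<lambda>k. inverse (real k + 2) * inverse (real k + 3)) \<longlonglongrightarrow> 0 * 0"
    by (intro tendsto_mult tendsto_inverse_0_at_top filterlim_add_real_nat)
  then have "(\<lambda>k. (1 / 2) * (inverse (real k + 2) * inverse (real k + 3))) \<longlonglongrightarrow> 1 / 2 * (0 * 0)"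
    by (rule tendsto_mult_left)
  from telescope_sums'[OF this]
  have "(\<lambda>k. (1 / 2) * (inverse (real k + 2) * inverse (real k + 3)) -
      (1 / 2) * (inverse (real (Suc k) + 2) * inverse (real (Suc k) + 3))) sums (1 / 12)" by simp
  moreover have "(1 / 2) * (inverse (real k + 2) * inverse (real k + 3)) -
      (1 / 2) * (inverse (real (Suc k) + 2) * inverse (real (Suc k) + 3)) =
      1 / ((real k + 2) * (real k + 3) * (real k + 4))" for k
    by (simp add: divide_simps) (simp add: algebra_simps)
  ultimately show ?thesis by simp
qed

text \<open>Since the weights sum to 1, any constant \<open>c\<close> can be subtracted in the second summand.\<close>

lemma gauss_op_diff:
  assumes s: "s \<ge> 0" and t: "t \<ge> 0"
    and "summable (\<lambda>k. gauss_weight s k * f (gauss_branch k s))"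
    and "summable (\<lambda>k. gauss_weight t k * f (gauss_branch k t))"
  shows "(\<lambda>k. gauss_weight s k * (f (gauss_branch k s) - f (gauss_branch k t))
            + (gauss_weight s k - gauss_weight t k) * (f (gauss_branch k t) - c))
         sums (gauss_op f s - gauss_op f t)"
proof -
  have "(\<lambda>k. gauss_weight s k * f (gauss_branch k s) - gauss_weight t k * f (gauss_branch k t)
      - (gauss_weight s k * c - gauss_weight t k * c)) sums
      (gauss_op f s - gauss_op f t - (1 * c - 1 * c))"
    unfolding gauss_op_def using assms
    by (intro sums_diff sums_mult2 gauss_weight_sums summable_sums) auto
  then show ?thesis by (simp add: algebra_simps)
qed

lemma sums_abs_le:
  fixes f g :: "nat \<Rightarrow> real"
  assumes "f sums a" "g sums b" "\<And>k. \<bar>f k\<bar> \<le> g k"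
  shows "\<bar>a\<bar> \<le> b"
proof -
  have "norm (suminf f) \<le> suminf g" using assms by (intro norm_suminf_le) (auto simp: sums_iff)
  then show ?thesis using assms(1,2) by (simp add: sums_iff)
qed

text \<open>Two effects are separated by \<open>gauss_op_diff\<close>, subtracting
  \<open>f 0\<close>. Moving the branches: branch 0 has slope at most 1 and weight at most 1/2, the
  others slope at most 1/4, together 1/4 + 3/4 * 1/2 = 5/8. Changing the weights: after the
  subtraction the value on branch \<open>k\<close> is at most \<open>c / (k + 1)\<close>, so only
  the Lipschitz constant enters, with factor 1/4 + 1/12 = 1/3. The sum is 23/24; any constant below
  1 would serve.\<close>

lemma gauss_op_lipschitz:
  assumes f: "c-lipschitz_on {0..1} f"
  shows "(23 / 24 * c)-lipschitz_on {0..1} (gauss_op f)"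
proof (rule lipschitz_onI)
  have c: "c \<ge> 0" by (rule lipschitz_on_nonneg[OF f])
  then show "0 \<le> 23 / 24 * c" by simp
  fix s t :: real assume st: "s \<in> {0..1}" "t \<in> {0..1}"
  then have st0: "s \<ge> 0" "t \<ge> 0" by auto
  have lip: "\<bar>f x - f y\<bar> \<le> c * \<bar>x - y\<bar>" if "x \<in> {0..1}" "y \<in> {0..1}" for x y
    using lipschitz_onD[OF f that] by (simp add: dist_real_def)
  let ?d = "c * \<bar>s - t\<bar>"
  have "?d \<ge> 0" using c by simp
  let ?w = "\<lambda>k. gauss_weight s k * (1 / 4) + (if k = 0 then gauss_weight s 0 * (3 / 4) else 0)"
  define e where "e = (\<lambda>k. case k of 0 \<Rightarrow> 1 / 4 | Suc j \<Rightarrow> 1 / ((real j + 2) * (real j + 3) * (real j + 4)))"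
  have w: "?w sums (1 * (1 / 4) + gauss_weight s 0 * (3 / 4))"
    by (intro sums_add sums_mult2 gauss_weight_sums st0 sums_single)
  have "e sums (1 / 12 + e 0)"
    by (subst sums_Suc_iff[symmetric]) (use triple_product_sums in \<open>simp add: e_def\<close>)
  then have e: "e sums (1 / 3)" by (simp add: e_def)
  have le: "\<bar>gauss_weight s k * (f (gauss_branch k s) - f (gauss_branch k t))
            + (gauss_weight s k - gauss_weight t k) * (f (gauss_branch k t) - f 0)\<bar>
      \<le> ?d * (?w k + e k)" (is "\<bar>?x + ?y\<bar> \<le> _") for k
  proof -
    have "\<bar>f (gauss_branch k s) - f (gauss_branch k t)\<bar> \<le> c * (\<bar>s - t\<bar> / (real k + 1)\<^sup>2)"
      using lip[of "gauss_branch k s" "gauss_branch k t"] gauss_branch_bounds st0 c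
        gauss_branch_diff[OF st0, of k] by (meson mult_left_mono order_trans)
    also have "\<dots> \<le> ?d * (if k = 0 then 1 else 1 / 4)"
    proof (cases "k = 0")
      case False
      then have "2 * 2 \<le> (real k + 1)\<^sup>2" unfolding power2_eq_square by (intro mult_mono) auto
      then have "?d / (real k + 1)\<^sup>2 \<le> ?d / 4" using \<open>?d \<ge> 0\<close> by (intro divide_left_mono) auto
      then show ?thesis using False by simp
    qed simp
    finally have "\<bar>?x\<bar> \<le> gauss_weight s k * (?d * (if k = 0 then 1 else 1 / 4))"
      using gauss_weight_nonneg[OF st0(1), of k] by (simp add: abs_mult mult_left_mono)
    also have "\<dots> = ?d * ?w k" by (simp add: algebra_simps)
    finally have x: "\<bar>?x\<bar> \<le> ?d * ?w k" .
    have "\<bar>f (gauss_branch k t) - f 0\<bar> \<le> c * gauss_branch k t"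
      using lip[of "gauss_branch k t" 0] gauss_branch_bounds[OF st0(2), of k] by simp
    also have "\<dots> \<le> c * (1 / (real k + 1))"
      unfolding gauss_branch_def using st0 c by (intro mult_left_mono divide_left_mono) auto
    finally have fk: "\<bar>f (gauss_branch k t) - f 0\<bar> \<le> c * (1 / (real k + 1))" .
    have "\<bar>?y\<bar> \<le> ?d * e k"
    proof (cases k)
      case 0
      have "\<bar>?y\<bar> \<le> (\<bar>s - t\<bar> / 4) * (c * 1)"
        unfolding abs_mult using 0 fk gauss_weight_diff_0[OF st] by (intro mult_mono) auto
      then show ?thesis using 0 by (simp add: e_def algebra_simps)
    next
      case (Suc j)
      have "\<bar>?y\<bar> \<le> (\<bar>s - t\<bar> * (1 / ((real j + 3) * (real j + 4)))) * (c * (1 / (real k + 1)))"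
        unfolding abs_mult using fk gauss_weight_diff_Suc[OF st] Suc by (intro mult_mono) auto
      then show ?thesis using Suc by (simp add: e_def algebra_simps)
    qed
    with x show ?thesis by (simp add: distrib_left)
  qed
  have "\<bar>gauss_op f s - gauss_op f t\<bar> \<le> ?d * ((1 * (1 / 4) + gauss_weight s 0 * (3 / 4)) + 1 / 3)"
    by (rule sums_abs_le[OF gauss_op_diff[OF st0 lipschitz_gauss_summable[OF f st(1)] lipschitz_gauss_summable[OF f st(2)]]
          sums_mult[OF sums_add[OF w e]] le])
  also have "\<dots> \<le> ?d * (23 / 24)"
  proof (intro mult_left_mono)
    have "gauss_weight s 0 \<le> 1 / 2" using st unfolding gauss_weight_def by (simp add: divide_simps)
    then show "(1 * (1 / 4) + gauss_weight s 0 * (3 / 4)) + 1 / 3 \<le> 23 / 24" by simp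
  qed fact
  finally show "dist (gauss_op f s) (gauss_op f t) \<le> 23 / 24 * c * dist s t"
    by (simp add: dist_real_def algebra_simps)
qed

lemma gauss_op_funpow_lipschitz: "c-lipschitz_on {0..1} f \<Longrightarrow> ((23 / 24) ^ m * c)-lipschitz_on {0..1} ((gauss_op ^^ m) f)"
proof (induction m)
  case (Suc m)
  then show ?case using gauss_op_lipschitz[of "(23 / 24) ^ m * c"] by (simp add: mult.assoc)
qed simp

section \<open>The unbounded observable \<open>- ln\<close>\<close>

lemma summable_gauss_tail: "summable (\<lambda>k. (real k + 1) powr (- 3 / 2))"
proof -
  have "summable (\<lambda>k. real k powr (- 3 / 2))" by (subst summable_real_powr_iff) simp
  then show ?thesis by (subst (asm) summable_Suc_iff[symmetric]) (simp add: add.commute)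
qed

text \<open>The common majorant of the unbounded sums: the weights decay like
  \<open>1 / (k + 1)^2\<close>, while the logarithm and later the remainder of the exponential grow
  at most like a square root.\<close>

lemma square_root_tail: "1 / (real k + 1)\<^sup>2 * (real k + 1) powr (1 / 2) = (real k + 1) powr (- 3 / 2)"
proof -
  have "(real k + 1)\<^sup>2 = (real k + 1) powr 2" by (simp add: powr_numeral)
  then have "1 / (real k + 1)\<^sup>2 * (real k + 1) powr (1 / 2) = (real k + 1) powr (1 / 2) / (real k + 1) powr 2"
    by (simp only:) simp
  also have "\<dots> = (real k + 1) powr (1 / 2 - 2)" by (rule powr_diff[symmetric])
  finally show ?thesis by simp
qed

text \<open>This is \<open>ln y <= y\<close> applied to the square root. The factor 4 is a perfect
  square and leaves the root as a 2.\<close>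

lemma ln_le_sqrt:
  assumes "t \<in> {0..1}"
  shows "ln (real k + 1 + t) \<le> 4 * (real k + 1) powr (1 / 2)"
proof -
  have "ln (real k + 1 + t) \<le> ln (4 * (real k + 1))" using assms by (intro ln_mono) auto
  also have "\<dots> = 2 * ln (sqrt (4 * (real k + 1)))" by (simp add: ln_sqrt)
  also have "\<dots> \<le> 2 * sqrt (4 * (real k + 1))"
  proof -
    have "ln x \<le> x" if "x > 0" for x :: real using ln_le_minus_one[OF that] by simp
    then show ?thesis by simp
  qed
  finally show ?thesis by (simp only: real_sqrt_mult powr_half_sqrt) simp
qed

lemma gauss_op_neg_ln_summable:
  assumes "s \<in> {0..1}"
  shows "summable (\<lambda>k. gauss_weight s k * - ln (gauss_branch k s))"
proof (rule summable_comparison_test')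
  show "summable (\<lambda>k. 8 * (real k + 1) powr (- 3 / 2))"
    by (intro summable_mult summable_gauss_tail)
  fix k
  have "- ln (gauss_branch k s) = ln (real k + 1 + s)" "ln (real k + 1 + s) \<ge> 0"
    using assms by (auto simp: gauss_branch_def ln_div)
  then have "norm (gauss_weight s k * - ln (gauss_branch k s)) = gauss_weight s k * ln (real k + 1 + s)"
    using gauss_weight_nonneg[of s k] assms by (simp add: abs_mult)
  also have "\<dots> \<le> (2 / (real k + 1)\<^sup>2) * (4 * (real k + 1) powr (1 / 2))"
    using gauss_weight_le[OF assms] ln_le_sqrt[OF assms] \<open>ln (real k + 1 + s) \<ge> 0\<close> by (intro mult_mono) auto
  also have "\<dots> = 8 * (real k + 1) powr (- 3 / 2)" by (simp add: square_root_tail[symmetric] del: minus_divide_left divide_minus_left)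
  finally show "norm (gauss_weight s k * - ln (gauss_branch k s)) \<le> 8 * (real k + 1) powr (- 3 / 2)" .
qed

text \<open>Averaging removes the singularity at 0: on branch \<open>k\<close> the function becomes
  \<open>ln (k + 1 + s)\<close>, of slope at most 1, and the change of the weights, of order
  \<open>1 / (k + 1)^2\<close>, beats the logarithm. Only some finite constant is wanted, so 0 is
  subtracted in \<open>gauss_op_diff\<close>.\<close>

lemma gauss_op_neg_ln_lipschitz: "\<exists>c. c-lipschitz_on {0..1} (gauss_op (\<lambda>x. - ln x))"
proof
  let ?f = "\<lambda>x::real. - ln x"
  show "(1 + 4 * (\<Sum>k. (real k + 1) powr (- 3 / 2)))-lipschitz_on {0..1} (gauss_op ?f)"
  proof (rule lipschitz_onI)
    show "0 \<le> 1 + 4 * (\<Sum>k. (real k + 1) powr (- 3 / 2))"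
      by (intro add_nonneg_nonneg mult_nonneg_nonneg suminf_nonneg summable_gauss_tail) auto
    fix s t :: real assume st: "s \<in> {0..1}" "t \<in> {0..1}"
    then have st0: "s \<ge> 0" "t \<ge> 0" by auto
    let ?b = "\<lambda>k. gauss_weight s k * \<bar>s - t\<bar> + \<bar>s - t\<bar> * (4 * (real k + 1) powr (- 3 / 2))"
    have b: "?b sums (1 * \<bar>s - t\<bar> + \<bar>s - t\<bar> * (4 * (\<Sum>k. (real k + 1) powr (- 3 / 2))))"
      by (intro sums_add sums_mult sums_mult2 gauss_weight_sums st0 summable_sums summable_gauss_tail)
    have le: "\<bar>gauss_weight s k * (?f (gauss_branch k s) - ?f (gauss_branch k t))
            + (gauss_weight s k - gauss_weight t k) * (?f (gauss_branch k t) - 0)\<bar>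
      \<le> ?b k" (is "\<bar>?x + ?y\<bar> \<le> _") for k
    proof -
      have eq: "?f (gauss_branch k s) = ln (real k + 1 + s)" "?f (gauss_branch k t) = ln (real k + 1 + t)"
        using st by (auto simp: gauss_branch_def ln_div)
      have aux: "ln (real k + 1 + x) - ln (real k + 1 + y) \<le> \<bar>x - y\<bar>" if "x \<ge> 0" "y \<ge> 0" for x y
      proof -
        have "ln (real k + 1 + x) - ln (real k + 1 + y) \<le> (x - y) / (real k + 1 + y)"
          using ln_diff_le[of "real k + 1 + x" "real k + 1 + y"] that by simp
        also have "\<dots> \<le> \<bar>x - y\<bar> / (real k + 1 + y)" using that by (intro divide_right_mono) auto
        also have "\<dots> \<le> \<bar>x - y\<bar> / 1" using that by (intro divide_left_mono) auto
        finally show ?thesis by simp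
      qed
      have "\<bar>ln (real k + 1 + s) - ln (real k + 1 + t)\<bar> \<le> \<bar>s - t\<bar>"
        using aux[OF st0] aux[OF st0(2,1)] by (simp add: abs_le_iff abs_minus_commute)
      then have x: "\<bar>?x\<bar> \<le> gauss_weight s k * \<bar>s - t\<bar>"
        unfolding abs_mult eq using gauss_weight_nonneg[OF st0(1), of k] by (simp add: mult_left_mono)
      have "ln (real k + 1 + t) \<ge> 0" using st by simp
      then have "\<bar>?y\<bar> \<le> (\<bar>s - t\<bar> * (1 / (real k + 1)\<^sup>2)) * (4 * (real k + 1) powr (1 / 2))"
        unfolding abs_mult eq using gauss_weight_diff_le[OF st, of k] ln_le_sqrt[OF st(2), of k]
        by (intro mult_mono) auto
      then have "\<bar>?y\<bar> \<le> \<bar>s - t\<bar> * (4 * (real k + 1) powr (- 3 / 2))" by (simp add: square_root_tail[symmetric] del: minus_divide_left divide_minus_left)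
      with x show ?thesis by linarith
    qed
    have "\<bar>gauss_op ?f s - gauss_op ?f t\<bar> \<le> 1 * \<bar>s - t\<bar> + \<bar>s - t\<bar> * (4 * (\<Sum>k. (real k + 1) powr (- 3 / 2)))"
      by (rule sums_abs_le[OF gauss_op_diff[OF st0 gauss_op_neg_ln_summable[OF st(1)] gauss_op_neg_ln_summable[OF st(2)]] b le])
    then show "dist (gauss_op ?f s) (gauss_op ?f t) \<le> (1 + 4 * (\<Sum>k. (real k + 1) powr (- 3 / 2))) * dist s t"
      by (simp add: dist_real_def algebra_simps)
  qed
qed

section \<open>Invariance of the Gauss measure\<close>

lemma gauss_branch_measurable [measurable]: "gauss_branch k \<in> borel_measurable borel"
  unfolding gauss_branch_def[abs_def] by measurable

lemma gauss_cells:
  defines "A \<equiv> \<lambda>k. {1 / (real k + 2)..<1 / (real k + 1)}"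
  shows "disjoint_family A" "(\<Union>k. A k) = {0<..<1}"
proof -
  \<comment> \<open>The cells are closed on the left and open on the right, so membership reads
    \<open>k + 1 < 1 / z <= k + 2\<close> and fixes a ceiling, not a floor; \<open>z = 1\<close>
    falls outside.\<close>
  have A_iff: "z \<in> A k \<longleftrightarrow> 0 < z \<and> int k = \<lceil>1 / z\<rceil> - 2" for z k
  proof (cases "z > 0")
    case True
    have "z \<in> A k \<longleftrightarrow> real k + 1 < 1 / z \<and> 1 / z \<le> real k + 2"
      using True by (auto simp: A_def field_simps)
    also have "\<dots> \<longleftrightarrow> \<lceil>1 / z\<rceil> = int k + 2" by (simp add: ceiling_eq_iff add.commute)
    finally show ?thesis using True by auto
  next
    case False
    moreover have "0 < 1 / (real k + 2)" by simp
    ultimately show ?thesis unfolding A_def by (metis atLeastLessThan_iff less_le_trans)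
  qed
  show "disjoint_family A"
    unfolding disjoint_family_on_def by (auto simp: A_iff)
  show "(\<Union>k. A k) = {0<..<1}"
  proof (intro set_eqI iffI)
    fix z assume "z \<in> (\<Union>k. A k)"
    then obtain k where k: "z \<in> A k" by auto
    then have "z > 0" by (simp add: A_iff)
    have "z < 1 / (real k + 1)" using k by (simp add: A_def)
    also have "\<dots> \<le> 1" by simp
    finally show "z \<in> {0<..<1}" using \<open>z > 0\<close> by simp
  next
    fix z :: real assume z: "z \<in> {0<..<1}"
    then have "1 < 1 / z" by simp
    then have "2 \<le> \<lceil>1 / z\<rceil>" by linarith
    then have "z \<in> A (nat (\<lceil>1 / z\<rceil> - 2))" using z by (simp add: A_iff)
    then show "z \<in> (\<Union>k. A k)" by auto
  qed
qed

lemma nn_integral_gauss_cell: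
  fixes f :: "real \<Rightarrow> ennreal"
  assumes [measurable]: "f \<in> borel_measurable borel"
  shows "(\<integral>\<^sup>+z. f z * indicator {1 / (real k + 2)..<1 / (real k + 1)} z \<partial>lborel) =
    (\<integral>\<^sup>+y. f (gauss_branch k y) * ennreal ((gauss_branch k y)\<^sup>2) * indicator {0<..<1} y \<partial>lborel)"
proof -
  \<comment> \<open>The branch is decreasing, while the substitution rule asks for a nonnegative
    derivative. So \<open>g\<close> is the branch reflected by \<open>y -> 1 - y\<close>, and
    \<open>nn_integral_real_affine\<close> undoes the reflection.\<close>
  define g where "g = (\<lambda>y. 1 / (real k + 2 - y))"
  define g' where "g' = (\<lambda>y. (1 / (real k + 2 - y))\<^sup>2)"
  have [measurable]: "g \<in> borel_measurable borel" "g' \<in> borel_measurable borel"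
    unfolding g_def[abs_def] g'_def[abs_def] by measurable
  have ends: "g 0 = 1 / (real k + 2)" "g 1 = 1 / (real k + 1)"
    by (simp_all add: g_def add.commute)
  have "(\<integral>\<^sup>+z. f z * indicator {1 / (real k + 2)..<1 / (real k + 1)} z \<partial>lborel)
     = (\<integral>\<^sup>+z. f z * indicator {g 0..g 1} z \<partial>lborel)"
    unfolding ends using AE_lborel_singleton[of "1 / (real k + 1)"]
    by (intro nn_integral_cong_AE; eventually_elim) (auto simp: indicator_def)
  also have "\<dots> = (\<integral>\<^sup>+y. f (g y) * g' y * indicator {0..1} y \<partial>lborel)"
  proof (rule nn_integral_substitution_aux)
    show "(g has_real_derivative g' y) (at y)" if "y \<in> {0..1}" for y
      unfolding g_def g'_def using that
      by (auto intro!: derivative_eq_intros simp: power2_eq_square)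
    show "continuous_on {0..1} g'"
      unfolding g'_def by (intro continuous_intros) auto
  qed (auto simp: g'_def)
  also have "\<dots> = ennreal \<bar>-1\<bar> * (\<integral>\<^sup>+y. f (g (1 + (-1) * y)) * g' (1 + (-1) * y) * indicator {0..1} (1 + (-1) * y) \<partial>lborel)"
    by (rule nn_integral_real_affine) auto
  also have "\<dots> = (\<integral>\<^sup>+y. f (g (1 - y)) * g' (1 - y) * indicator {0..1} (1 - y) \<partial>lborel)"
    by simp
  also have "\<dots> = (\<integral>\<^sup>+y. f (gauss_branch k y) * ennreal ((gauss_branch k y)\<^sup>2) * indicator {0<..<1} y \<partial>lborel)"
  proof (intro nn_integral_cong_AE)
    have eq: "g (1 - y) = gauss_branch k y" "g' (1 - y) = (gauss_branch k y)\<^sup>2" for y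
      by (simp_all add: g_def g'_def gauss_branch_def algebra_simps)
    show "AE y in lborel. f (g (1 - y)) * g' (1 - y) * indicator {0..1} (1 - y) =
        f (gauss_branch k y) * ennreal ((gauss_branch k y)\<^sup>2) * indicator {0<..<1} y"
      unfolding eq
      using AE_lborel_singleton[of "0::real"] AE_lborel_singleton[of "1::real"]
      by eventually_elim (auto simp: indicator_def)
  qed
  finally show ?thesis .
qed

text \<open>Change of variables along the Gauss map, with Jacobian
  \<open>(gauss_branch k y)^2\<close>. It serves twice: for the invariant measure and for splitting
  off a partial quotient in \<open>cf_moment_Suc\<close>.\<close>

lemma nn_integral_gauss:
  fixes f :: "real \<Rightarrow> ennreal"
  assumes [measurable]: "f \<in> borel_measurable borel"
  shows "(\<integral>\<^sup>+z. f z * indicator {0<..<1} z \<partial>lborel) =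
    (\<Sum>k. \<integral>\<^sup>+y. f (gauss_branch k y) * ennreal ((gauss_branch k y)\<^sup>2) * indicator {0<..<1} y \<partial>lborel)"
proof -
  have "(\<integral>\<^sup>+z. f z * indicator {0<..<1} z \<partial>lborel) =
     (\<integral>\<^sup>+z. (\<Sum>k. f z * indicator {1 / (real k + 2)..<1 / (real k + 1)} z) \<partial>lborel)"
    by (simp add: suminf_indicator[OF gauss_cells(1)] gauss_cells(2))
  also have "\<dots> = (\<Sum>k. \<integral>\<^sup>+z. f z * indicator {1 / (real k + 2)..<1 / (real k + 1)} z \<partial>lborel)"
    by (rule nn_integral_suminf) measurable
  finally show ?thesis by (simp only: nn_integral_gauss_cell[OF assms])
qed

section \<open>Mass and mean for the unnormalised Gauss density \<open>1 / (1 + x)\<close>\<close>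

lemma ln_two_integral:
  "(\<integral>\<^sup>+x. ennreal (1 / (1 + x)) * indicator {0<..<1} x \<partial>lborel) = ennreal (ln 2)"
proof -
  have "(\<integral>\<^sup>+x. ennreal (1 / (1 + x)) * indicator {0<..<1} x \<partial>lborel)
      = (\<integral>\<^sup>+x. ennreal (1 / (1 + x)) * indicator {0..1} x \<partial>lborel)"
    using AE_lborel_singleton[of "0::real"] AE_lborel_singleton[of "1::real"]
    by (intro nn_integral_cong_AE; eventually_elim) (auto simp: indicator_def)
  also have "\<dots> = ennreal (ln (1 + 1) - ln (1 + 0))"
    by (rule nn_integral_FTC_Icc[where F = "\<lambda>x. ln (1 + x)"])
       (auto intro!: derivative_eq_intros simp: has_real_derivative_iff_has_vector_derivative[symmetric])
  finally show ?thesis by simp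
qed

text \<open>The full series minus twice its terms with even \<open>n + 1\<close>, which make up a
  quarter of it.\<close>

lemma alternating_inverse_squares_sums: "(\<lambda>n. (-1) ^ n / (real n + 1)\<^sup>2) sums (pi\<^sup>2 / 12)"
proof -
  have all: "(\<lambda>n. 1 / (real n + 1)\<^sup>2) sums (pi\<^sup>2 / 6)"
    using inverse_squares_sums by (simp add: add.commute)
  let ?b = "\<lambda>n. if odd n then 2 / (real n + 1)\<^sup>2 else 0"
  have "(\<lambda>m. ?b (2 * m + 1)) sums (1 / 2 * (pi\<^sup>2 / 6))"
  proof -
    have "?b (2 * m + 1) = 1 / 2 * (1 / (real m + 1)\<^sup>2)" for m
    proof -
      have "real (2 * m + 1) + 1 = 2 * (real m + 1)" by simp
      then show ?thesis by (simp only: power_mult_distrib) simp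
    qed
    then show ?thesis using sums_mult[OF all, of "1 / 2"] by (simp only:)
  qed
  then have "?b sums (1 / 2 * (pi\<^sup>2 / 6))"
    by (subst (asm) sums_mono_reindex) (auto simp: strict_mono_def, metis Suc_eq_plus1 oddE rangeI)
  from sums_diff[OF all this]
  have "(\<lambda>n. 1 / (real n + 1)\<^sup>2 - ?b n) sums (pi\<^sup>2 / 12)" by simp
  moreover have "1 / (real n + 1)\<^sup>2 - ?b n = (-1) ^ n / (real n + 1)\<^sup>2" for n
    by (cases "even n") (auto simp: diff_divide_distrib[symmetric])
  ultimately show ?thesis by simp
qed

text \<open>\<open>- Li\<^sub>2(- x)\<close>, which makes \<open>- ln x * ln (1 + x) - Li\<^sub>2(- x)\<close> an antiderivative of \<open>- ln x / (1 + x)\<close>.\<close>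

definition dilog_alt :: "real \<Rightarrow> real" where
  "dilog_alt x = (\<Sum>n. (-1) ^ n / (real n + 1)\<^sup>2 * x ^ Suc n)"

lemma dilog_alt_deriv:
  assumes "0 < x" "x < 1"
  shows "(dilog_alt has_real_derivative ln (1 + x) / x) (at x)"
proof -
  have eq: "(-1) ^ n / (real n + 1)\<^sup>2 * real (Suc n) = (-1) ^ n / (real n + 1)" for n
    by (simp add: power2_eq_square add.commute)
  have sm: "summable (\<lambda>n. (-1) ^ n / (real n + 1)\<^sup>2 * real (Suc n) * y ^ n)" if "y \<in> {-1<..<1}" for y :: real
    unfolding eq
  proof (rule summable_comparison_test')
    show "summable (\<lambda>n. \<bar>y\<bar> ^ n)" using that by (intro summable_geometric) auto
    show "norm ((- 1) ^ n / (real n + 1) * y ^ n) \<le> \<bar>y\<bar> ^ n" for n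
      by (simp add: abs_mult power_abs divide_simps mult_le_cancel_left1)
  qed
  have "((\<lambda>x. \<Sum>n. (-1) ^ n / (real n + 1)\<^sup>2 * x ^ Suc n) has_real_derivative
      (\<Sum>n. (-1) ^ n / (real n + 1)\<^sup>2 * real (Suc n) * x ^ n)) (at x)"
    by (rule DERIV_power_series'[where R = 1]) (use assms sm in auto)
  moreover have "(\<Sum>n. (-1) ^ n / (real n + 1)\<^sup>2 * real (Suc n) * x ^ n) = ln (1 + x) / x"
  proof -
    have "ln (1 + x) = (\<Sum>n. x * ((-1) ^ n / (real n + 1)\<^sup>2 * real (Suc n) * x ^ n))"
      using ln_series[of "1 + x"] assms unfolding eq by (simp add: algebra_simps)
    also have "\<dots> = x * (\<Sum>n. (-1) ^ n / (real n + 1)\<^sup>2 * real (Suc n) * x ^ n)"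
      by (rule suminf_mult) (use sm assms in auto)
    finally show ?thesis using assms by simp
  qed
  ultimately show ?thesis unfolding dilog_alt_def[abs_def] by simp
qed

text \<open>The point is the endpoint 1: it lies on the boundary of the disc of convergence, and the
  value pi^2 / 12 is taken there.\<close>

lemma dilog_alt_continuous: "continuous_on {0..1} dilog_alt"
proof -
  have "uniform_limit {0..1} (\<lambda>n x. \<Sum>i<n. (-1) ^ i / (real i + 1)\<^sup>2 * x ^ Suc i) dilog_alt sequentially"
    unfolding dilog_alt_def[abs_def]
  proof (rule Weierstrass_m_test[OF _ inverse_squares_summable])
    fix n :: nat and x :: real assume x: "x \<in> {0..1}"
    then have "\<bar>x ^ Suc n\<bar> \<le> 1" by (simp add: power_le_one mult_le_one)
    then show "norm ((- 1) ^ n / (real n + 1)\<^sup>2 * x ^ Suc n) \<le> 1 / (real n + 1)\<^sup>2"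
      by (simp add: abs_mult divide_right_mono)
  qed
  then show ?thesis
    by (rule uniform_limit_theorem[rotated]) (auto intro!: always_eventually continuous_intros)
qed

text \<open>The boundary term at 0 of an integration by parts: \<open>- ln x <= 2 / sqrt x\<close>
  against \<open>ln (1 + x) <= x\<close>.\<close>

lemma ln_mult_ln_tendsto_0: "((\<lambda>x. - ln x * ln (1 + x)) \<longlongrightarrow> 0) (at_right (0::real))"
proof (rule tendsto_sandwich[of "\<lambda>_. 0" _ _ "\<lambda>x. 2 * sqrt x"])
  have ev: "eventually (\<lambda>x::real. 0 < x \<and> x < 1) (at_right 0)"
    using eventually_at_right_real[of 0 1] by simp
  then show "\<forall>\<^sub>F x::real in at_right 0. 0 \<le> - ln x * ln (1 + x)"
    by eventually_elim (auto intro!: mult_nonpos_nonneg)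
  show "\<forall>\<^sub>F x::real in at_right 0. - ln x * ln (1 + x) \<le> 2 * sqrt x"
    using ev
  proof eventually_elim
    case (elim x)
    have "- ln x = 2 * ln (1 / sqrt x)" using elim by (simp add: ln_div ln_sqrt)
    also have "\<dots> \<le> 2 * (1 / sqrt x)"
      using ln_le_minus_one[of "1 / sqrt x"] elim by simp
    finally have 1: "- ln x \<le> 2 / sqrt x" by simp
    have "ln (1 + x) \<le> x" using elim by (intro ln_add_one_self_le_self) auto
    then have "- ln x * ln (1 + x) \<le> 2 / sqrt x * x"
      using 1 elim by (intro mult_mono) auto
    also have "\<dots> = 2 * sqrt x" using elim by (simp add: field_simps)
    finally show ?case .
  qed
  have "((\<lambda>x. 2 * sqrt x) \<longlongrightarrow> 2 * sqrt 0) (at_right (0::real))" by (intro tendsto_intros)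
  then show "((\<lambda>x. 2 * sqrt x) \<longlongrightarrow> 0) (at_right (0::real))" by simp
qed simp

text \<open>The product of logarithms vanishes at both ends, so only \<open>dilog_alt 1\<close>
  remains. The integrand is unbounded at 0, hence the fundamental theorem in its form with one-sided
  limits.\<close>

lemma neg_ln_integral:
  "(\<integral>\<^sup>+x. ennreal (- ln x / (1 + x)) * indicator {0<..<1} x \<partial>lborel) = ennreal (pi\<^sup>2 / 12)"
proof -
  let ?f = "\<lambda>x::real. - ln x / (1 + x)"
  let ?F = "\<lambda>x::real. - ln x * ln (1 + x) + dilog_alt x"
  have dilog: "dilog_alt 0 = 0" "dilog_alt 1 = pi\<^sup>2 / 12"
    using alternating_inverse_squares_sums by (auto simp: dilog_alt_def sums_iff)
  have "(dilog_alt \<longlongrightarrow> 0) (at_right 0)"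
    using continuous_on_Icc_at_rightD[OF dilog_alt_continuous] dilog by simp
  then have F0: "(?F \<longlongrightarrow> 0 + 0) (at_right 0)" by (intro tendsto_add ln_mult_ln_tendsto_0)
  have "(dilog_alt \<longlongrightarrow> pi\<^sup>2 / 12) (at_left 1)"
    using continuous_on_Icc_at_leftD[OF dilog_alt_continuous] dilog by simp
  then have F1: "(?F \<longlongrightarrow> - ln 1 * ln (1 + 1) + pi\<^sup>2 / 12) (at_left 1)"
    by (intro tendsto_intros) auto
  have lim: "((?F \<circ> real_of_ereal) \<longlongrightarrow> 0) (at_right (ereal 0))"
      "((?F \<circ> real_of_ereal) \<longlongrightarrow> pi\<^sup>2 / 12) (at_left (ereal 1))"
    unfolding ereal_tendsto_simps using F0 F1 by simp_all
  note FTC = interval_integral_FTC_nonneg[of "ereal 0" "ereal 1" ?F ?f, OF _ _ _ _ lim]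
  have der: "(?F has_real_derivative ?f x) (at x)" if "0 < x" "x < 1" for x
  proof -
    have "((\<lambda>x. - ln x) has_real_derivative - (1 / x)) (at x)"
      "((\<lambda>x. ln (1 + x)) has_real_derivative 1 / (1 + x)) (at x)"
      using that by (auto intro!: derivative_eq_intros)
    from DERIV_add[OF DERIV_mult[OF this] dilog_alt_deriv[OF that]]
    show ?thesis by (rule DERIV_cong) (simp add: field_simps)
  qed
  have cont: "isCont ?f x" if "0 < x" for x
    using that by (intro continuous_intros) auto
  have nn: "?f x \<ge> 0" if "0 < x" "x < 1" for x
    using that by (intro divide_nonneg_pos) auto
  have ev: "einterval (ereal 0) (ereal 1) = {0<..<1}" by (rule einterval_eq)
  have int: "set_integrable lborel {0<..<1} ?f"
    using FTC(1) der cont nn unfolding ev by (auto intro: AE_I2)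
  have val: "(LBINT x:{0<..<1}. ?f x) = pi\<^sup>2 / 12"
    using FTC(2) der cont nn by (auto simp: interval_lebesgue_integral_def ev intro: AE_I2)
  have "(\<integral>\<^sup>+x. ennreal (?f x) * indicator {0<..<1} x \<partial>lborel)
      = (\<integral>\<^sup>+x. ennreal (indicator {0<..<1} x *\<^sub>R ?f x) \<partial>lborel)"
    by (intro nn_integral_cong) (auto simp: indicator_def)
  also have "\<dots> = ennreal (LBINT x:{0<..<1}. ?f x)"
    unfolding set_lebesgue_integral_def
    using int nn by (intro nn_integral_eq_integral) (auto simp: set_integrable_def indicator_def intro!: AE_I2)
  finally show ?thesis unfolding val .
qed

section \<open>Conservation of the mean under the operator\<close>

lemma gauss_op_measurable [measurable]:
  assumes [measurable]: "f \<in> borel_measurable borel"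
  shows "gauss_op f \<in> borel_measurable borel"
  unfolding gauss_op_def[abs_def] gauss_weight_def by measurable

lemma gauss_op_nonneg:
  assumes "\<And>x. x \<in> {0<..1} \<Longrightarrow> f x \<ge> 0" "s \<ge> 0"
    "summable (\<lambda>k. gauss_weight s k * f (gauss_branch k s))"
  shows "gauss_op f s \<ge> 0"
  unfolding gauss_op_def using assms gauss_branch_bounds[OF assms(2)] gauss_weight_nonneg[OF assms(2)]
  by (intro suminf_nonneg mult_nonneg_nonneg) auto

text \<open>With \<open>b = gauss_branch k y\<close>, everything rests on
  \<open>b^2 / (1 + b) = gauss_weight y k / (1 + y)\<close>: Jacobian times density at the image is
  weight times density at \<open>y\<close>.\<close>

lemma gauss_measure_invariant:
  fixes f :: "real \<Rightarrow> real"
  assumes [measurable]: "f \<in> borel_measurable borel" and nn: "\<And>x. x \<in> {0<..1} \<Longrightarrow> f x \<ge> 0"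
    and sm: "\<And>s. s \<in> {0..1} \<Longrightarrow> summable (\<lambda>k. gauss_weight s k * f (gauss_branch k s))"
  shows "(\<integral>\<^sup>+x. ennreal (gauss_op f x / (1 + x)) * indicator {0<..<1} x \<partial>lborel)
    = (\<integral>\<^sup>+x. ennreal (f x / (1 + x)) * indicator {0<..<1} x \<partial>lborel)"
proof -
  have "(\<integral>\<^sup>+x. ennreal (f x / (1 + x)) * indicator {0<..<1} x \<partial>lborel) =
    (\<Sum>k. \<integral>\<^sup>+y. ennreal (f (gauss_branch k y) / (1 + gauss_branch k y)) * ennreal ((gauss_branch k y)\<^sup>2)
        * indicator {0<..<1} y \<partial>lborel)"
    by (rule nn_integral_gauss) measurable
  also have "\<dots> = (\<integral>\<^sup>+y. (\<Sum>k. ennreal (f (gauss_branch k y) / (1 + gauss_branch k y)) * ennreal ((gauss_branch k y)\<^sup>2)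
        * indicator {0<..<1} y) \<partial>lborel)"
    by (rule nn_integral_suminf[symmetric]) measurable
  also have "\<dots> = (\<integral>\<^sup>+y. ennreal (gauss_op f y / (1 + y)) * indicator {0<..<1} y \<partial>lborel)"
  proof (intro nn_integral_cong)
    fix y :: real
    show "(\<Sum>k. ennreal (f (gauss_branch k y) / (1 + gauss_branch k y)) * ennreal ((gauss_branch k y)\<^sup>2)
        * indicator {0<..<1} y) = ennreal (gauss_op f y / (1 + y)) * indicator {0<..<1} y"
    proof (cases "y \<in> {0<..<1}")
      case True
      then have y0: "y \<ge> 0" by simp
      have fn: "f (gauss_branch k y) \<ge> 0" for k using gauss_branch_bounds[OF y0, of k] nn by auto
      have "ennreal (f (gauss_branch k y) / (1 + gauss_branch k y)) * ennreal ((gauss_branch k y)\<^sup>2)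
          = ennreal (gauss_weight y k * f (gauss_branch k y) / (1 + y))" for k
      proof -
        have p: "real k + 1 + y \<noteq> 0" "real k + 2 + y \<noteq> 0" "1 + y \<noteq> 0" using True by auto
        have "1 / (1 + gauss_branch k y) * (gauss_branch k y)\<^sup>2 = gauss_weight y k / (1 + y)"
          unfolding gauss_branch_def gauss_weight_def using p
          by (simp add: divide_simps power2_eq_square)
        then have "f (gauss_branch k y) / (1 + gauss_branch k y) * (gauss_branch k y)\<^sup>2
          = gauss_weight y k * f (gauss_branch k y) / (1 + y)"
          by (metis (no_types, opaque_lifting) divide_inverse mult.assoc mult.commute mult.left_neutral)
        then show ?thesis by (simp add: ennreal_mult''[symmetric])
      qed
      moreover have "(\<Sum>k. ennreal (gauss_weight y k * f (gauss_branch k y) / (1 + y))) = ennreal (gauss_op f y / (1 + y))"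
        unfolding gauss_op_def
        using sm[of y] True fn gauss_weight_nonneg[OF y0]
        by (subst suminf_ennreal2) (auto simp: suminf_divide intro!: summable_divide)
      ultimately show ?thesis using True by simp
    qed simp
  qed
  finally show ?thesis by simp
qed

text \<open>Measurability and nonnegativity are carried through the induction because the mean is an
  \<open>nn_integral\<close>.\<close>

lemma gauss_op_funpow_integral:
  fixes \<psi> :: "real \<Rightarrow> real"
  defines "\<psi> \<equiv> gauss_op (\<lambda>x. - ln x)"
  shows "(gauss_op ^^ m) \<psi> \<in> borel_measurable borel \<and> (\<forall>x\<in>{0..1}. (gauss_op ^^ m) \<psi> x \<ge> 0) \<and>
    (\<integral>\<^sup>+x. ennreal ((gauss_op ^^ m) \<psi> x / (1 + x)) * indicator {0<..<1} x \<partial>lborel) = ennreal (pi\<^sup>2 / 12)"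
proof (induction m)
  case 0
  have 1: "(\<lambda>x::real. - ln x) \<in> borel_measurable borel" by measurable
  have "\<psi> x \<ge> 0" if "x \<in> {0..1}" for x
    unfolding \<psi>_def by (rule gauss_op_nonneg) (use that gauss_op_neg_ln_summable[OF that] in auto)
  moreover have "\<psi> \<in> borel_measurable borel" unfolding \<psi>_def using 1 by measurable
  moreover have "(\<integral>\<^sup>+x. ennreal (\<psi> x / (1 + x)) * indicator {0<..<1} x \<partial>lborel) = ennreal (pi\<^sup>2 / 12)"
    unfolding \<psi>_def neg_ln_integral[symmetric]
    by (rule gauss_measure_invariant[OF 1]) (use gauss_op_neg_ln_summable in auto)
  ultimately show ?case by simp
next
  case (Suc m)
  let ?f = "(gauss_op ^^ m) \<psi>"
  obtain c where "c-lipschitz_on {0..1} \<psi>" using gauss_op_neg_ln_lipschitz unfolding \<psi>_def by blast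
  then have "((23 / 24) ^ m * c)-lipschitz_on {0..1} ?f" by (rule gauss_op_funpow_lipschitz)
  note sm = lipschitz_gauss_summable[OF this]
  from Suc have [measurable]: "?f \<in> borel_measurable borel" and nn: "\<And>x. x \<in> {0..1} \<Longrightarrow> ?f x \<ge> 0" by auto
  have "gauss_op ?f x \<ge> 0" if "x \<in> {0..1}" for x
    by (rule gauss_op_nonneg) (use that nn sm[OF that] in auto)
  moreover have "gauss_op ?f \<in> borel_measurable borel" by measurable
  moreover have "(\<integral>\<^sup>+x. ennreal (gauss_op ?f x / (1 + x)) * indicator {0<..<1} x \<partial>lborel)
      = (\<integral>\<^sup>+x. ennreal (?f x / (1 + x)) * indicator {0<..<1} x \<partial>lborel)"
    by (rule gauss_measure_invariant) (use nn sm in auto)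
  ultimately show ?case using Suc by simp
qed

lemma gauss_mean_scaled:
  assumes "a \<ge> 0"
  shows "(\<integral>\<^sup>+x. ennreal (a / (1 + x)) * indicator {0<..<1} x \<partial>lborel) = ennreal (a * ln 2)"
proof -
  have "(\<integral>\<^sup>+x. ennreal (a / (1 + x)) * indicator {0<..<1} x \<partial>lborel) =
      (\<integral>\<^sup>+x. ennreal a * (ennreal (1 / (1 + x)) * indicator {0<..<1} x) \<partial>lborel)"
    using assms by (intro nn_integral_cong) (auto simp: indicator_def ennreal_mult[symmetric])
  also have "\<dots> = ennreal a * ennreal (ln 2)"
    by (subst nn_integral_cmult) (auto simp: ln_two_integral)
  finally show ?thesis using assms by (simp add: ennreal_mult)
qed

text \<open>Levy's constant, the almost sure limit of \<open>ln q_n / n\<close>. The error of the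
  \<open>n\<close>-th convergent behaves like \<open>1 / q_n^2\<close>, so the threshold for
  \<open>ln \<beta>\<close> is \<open>2 * levy_const\<close>.\<close>

definition levy_const :: real where "levy_const = pi\<^sup>2 / (12 * ln 2)"

text \<open>The iterate oscillates on the unit interval by at most its Lipschitz constant, and its
  Gauss mean is \<open>levy_const\<close>; hence each single value is that close to the
  mean.\<close>

lemma gauss_op_funpow_close:
  assumes c: "c-lipschitz_on {0..1} (gauss_op (\<lambda>x. - ln x))" and s: "s \<in> {0..1}"
  shows "\<bar>(gauss_op ^^ m) (gauss_op (\<lambda>x. - ln x)) s - levy_const\<bar> \<le> (23 / 24) ^ m * c"
proof -
  let ?f = "(gauss_op ^^ m) (gauss_op (\<lambda>x. - ln x))" and ?d = "(23 / 24) ^ m * c"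
  have "c \<ge> 0" by (rule lipschitz_on_nonneg[OF c])
  then have d: "?d \<ge> 0" by simp
  have osc: "\<bar>?f x - ?f s\<bar> \<le> ?d" if "x \<in> {0..1}" for x
  proof -
    have "\<bar>?f x - ?f s\<bar> \<le> ?d * \<bar>x - s\<bar>"
      using lipschitz_onD[OF gauss_op_funpow_lipschitz[OF c, of m] that s] by (simp add: dist_real_def)
    also have "\<dots> \<le> ?d * 1" using that s d by (intro mult_left_mono) auto
    finally show ?thesis by simp
  qed
  note int = gauss_op_funpow_integral[of m]
  have "ennreal (pi\<^sup>2 / 12) \<le> (\<integral>\<^sup>+x. ennreal ((?f s + ?d) / (1 + x)) * indicator {0<..<1} x \<partial>lborel)"
    unfolding int[THEN conjunct2, THEN conjunct2, symmetric]
  proof (intro nn_integral_mono)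
    fix x
    show "ennreal (?f x / (1 + x)) * indicator {0<..<1} x \<le> ennreal ((?f s + ?d) / (1 + x)) * indicator {0<..<1} x"
      using osc[of x] by (auto simp: indicator_def intro!: ennreal_leI divide_right_mono)
  qed
  also have "\<dots> = ennreal ((?f s + ?d) * ln 2)" using int s d by (intro gauss_mean_scaled) auto
  finally have "pi\<^sup>2 / 12 \<le> (?f s + ?d) * ln 2"
    using int s d by (subst (asm) ennreal_le_iff) auto
  then have 1: "levy_const \<le> ?f s + ?d" unfolding levy_const_def by (simp add: field_simps)
  \<comment> \<open>The lower bound may be negative; it is cut off at 0 to survive the passage
    through \<open>ennreal\<close>.\<close>
  have "ennreal (max 0 (?f s - ?d) * ln 2) = (\<integral>\<^sup>+x. ennreal (max 0 (?f s - ?d) / (1 + x)) * indicator {0<..<1} x \<partial>lborel)"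
    by (intro gauss_mean_scaled[symmetric]) auto
  also have "\<dots> \<le> ennreal (pi\<^sup>2 / 12)"
    unfolding int[THEN conjunct2, THEN conjunct2, symmetric]
  proof (intro nn_integral_mono)
    fix x
    show "ennreal (max 0 (?f s - ?d) / (1 + x)) * indicator {0<..<1} x \<le> ennreal (?f x / (1 + x)) * indicator {0<..<1} x"
      using osc[of x] int by (auto simp: indicator_def intro!: ennreal_leI divide_right_mono)
  qed
  finally have "max 0 (?f s - ?d) * ln 2 \<le> pi\<^sup>2 / 12"
    by (subst (asm) ennreal_le_iff) auto
  then have "max 0 (?f s - ?d) \<le> pi\<^sup>2 / 12 / ln 2" by (subst pos_le_divide_eq) auto
  then have "max 0 (?f s - ?d) \<le> levy_const" unfolding levy_const_def by simp
  with 1 show ?thesis by linarith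
qed

section \<open>Exponential moments\<close>

lemma exp_le_quadratic: "exp x \<le> 1 + x + x\<^sup>2 * exp \<bar>x\<bar>" for x :: real
proof -
  obtain t where t: "\<bar>t\<bar> \<le> \<bar>x\<bar>" "exp x = (\<Sum>m<2. x ^ m / fact m) + exp t / fact 2 * x ^ 2"
    using Maclaurin_exp_le[of x 2] by blast
  have "exp t / 2 \<le> exp \<bar>x\<bar>"
  proof -
    have "exp t \<le> exp \<bar>x\<bar>" using t(1) by simp
    then show ?thesis using exp_gt_zero[of t] by linarith
  qed
  then have "exp t / 2 * x\<^sup>2 \<le> exp \<bar>x\<bar> * x\<^sup>2" by (intro mult_right_mono) auto
  then show ?thesis using t(2) by (simp add: numeral_2_eq_2 algebra_simps)
qed

text \<open>\<open>x^2 / 32\<close> is the quadratic Taylor term of \<open>exp (|x| / 4)\<close>.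
  The rate 1/4, joined to \<open>exp |t x|\<close> with \<open>|t| <= 1/4\<close>, gives
  \<open>exp (|x| / 2)\<close>, which for a logarithm is a square root.\<close>

lemma square_le_exp: "x\<^sup>2 \<le> 32 * exp (\<bar>x\<bar> / 4)" for x :: real
proof -
  have "1 + \<bar>x\<bar> / 4 + (\<bar>x\<bar> / 4)\<^sup>2 / 2 \<le> exp (\<bar>x\<bar> / 4)" by (rule exp_lower_Taylor_quadratic) simp
  moreover have "(\<bar>x\<bar> / 4)\<^sup>2 = x\<^sup>2 / 16" by (simp add: power_divide)
  moreover have "0 \<le> \<bar>x\<bar> / 4" by simp
  ultimately show ?thesis by linarith
qed

text \<open>\<open>u\<close> is a truncated Neumann series, the sum of the first \<open>m\<close>
  iterates of \<open>gauss_op (- ln)\<close>. Then \<open>gauss_op u - u\<close> telescopes and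
  leaves the \<open>m\<close>-th iterate, which is uniformly close to
  \<open>levy_const\<close>.\<close>

lemma gauss_op_coboundary:
  assumes "\<epsilon> > 0"
  shows "\<exists>u U. (\<forall>x\<in>{0..1}. \<bar>u x\<bar> \<le> U) \<and>
    (\<forall>s\<in>{0..1}. \<bar>gauss_op (\<lambda>x. - ln x) s + gauss_op u s - u s - levy_const\<bar> \<le> \<epsilon>)"
proof -
  let ?\<psi> = "gauss_op (\<lambda>x. - ln x)"
  obtain c where c: "c-lipschitz_on {0..1} ?\<psi>" using gauss_op_neg_ln_lipschitz by blast
  have "(\<lambda>m. (23 / 24) ^ m * c) \<longlonglongrightarrow> 0 * c"
    by (intro tendsto_mult tendsto_const LIMSEQ_power_zero) auto
  then have "eventually (\<lambda>m. (23 / 24) ^ m * c < \<epsilon>) sequentially"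
    using assms by (simp add: order_tendsto_iff)
  then obtain m where m: "(23 / 24) ^ m * c < \<epsilon>"
    unfolding eventually_sequentially by blast
  define u where "u = (\<lambda>x. \<Sum>j<m. (gauss_op ^^ j) ?\<psi> x)"
  have lj: "((23 / 24) ^ j * c)-lipschitz_on {0..1} ((gauss_op ^^ j) ?\<psi>)" for j by (rule gauss_op_funpow_lipschitz[OF c])
  have "\<exists>B. \<forall>x\<in>{0..1}. \<bar>(gauss_op ^^ j) ?\<psi> x\<bar> \<le> B" for j by (rule lipschitz_on_unit_bounded[OF lj])
  then obtain B where B: "\<And>j x. x \<in> {0..1} \<Longrightarrow> \<bar>(gauss_op ^^ j) ?\<psi> x\<bar> \<le> B j" by metis
  have "\<bar>u x\<bar> \<le> (\<Sum>j<m. B j)" if "x \<in> {0..1}" for x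
    unfolding u_def using B[OF that] by (intro order.trans[OF sum_abs] sum_mono) auto
  moreover have "\<bar>?\<psi> s + gauss_op u s - u s - levy_const\<bar> \<le> \<epsilon>" if s: "s \<in> {0..1}" for s
  proof -
    have "gauss_op u s = (\<Sum>j<m. gauss_op ((gauss_op ^^ j) ?\<psi>) s)"
      unfolding u_def gauss_op_def[of _ s] sum_distrib_left
      by (rule suminf_sum) (rule lipschitz_gauss_summable[OF lj s])
    then have "gauss_op u s - u s = (\<Sum>j<m. (gauss_op ^^ Suc j) ?\<psi> s - (gauss_op ^^ j) ?\<psi> s)"
      unfolding u_def by (simp add: sum_subtractf)
    also have "\<dots> = (gauss_op ^^ m) ?\<psi> s - ?\<psi> s"
      using sum_lessThan_telescope[of "\<lambda>j. (gauss_op ^^ j) ?\<psi> s" m] by simp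
    finally have "?\<psi> s + gauss_op u s - u s = (gauss_op ^^ m) ?\<psi> s" by simp
    then show ?thesis using gauss_op_funpow_close[OF c s, of m] m by simp
  qed
  ultimately show ?thesis by blast
qed

text \<open>The corrected increment \<open>X k\<close> has mean within \<epsilon> of
  \<open>L\<close> from every \<open>s\<close>. Expanding \<open>exp (t * X k)\<close> to second
  order and using \<open>1 + y <= exp y\<close> gives a bound that multiplies over steps;
  \<open>exp (t * u)\<close> appears on both sides, so the corrections cancel between consecutive
  steps.\<close>

lemma gauss_exp_moment:
  fixes u :: "real \<Rightarrow> real"
  assumes u: "\<And>x. x \<in> {0..1} \<Longrightarrow> \<bar>u x\<bar> \<le> U"
    and mean: "\<And>s. s \<in> {0..1} \<Longrightarrow> \<bar>gauss_op (\<lambda>x. - ln x) s + gauss_op u s - u s - L\<bar> \<le> \<epsilon>"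
  shows "\<exists>K. \<forall>t s. \<bar>t\<bar> \<le> 1 / 4 \<longrightarrow> s \<in> {0..1} \<longrightarrow>
    summable (\<lambda>k. gauss_weight s k * (real k + 1 + s) powr t * exp (t * u (gauss_branch k s))) \<and>
    (\<Sum>k. gauss_weight s k * (real k + 1 + s) powr t * exp (t * u (gauss_branch k s)))
      \<le> exp (t * L + \<bar>t\<bar> * \<epsilon> + t\<^sup>2 * K) * exp (t * u s)"
proof -
  \<comment> \<open>The 64 is 32 from \<open>square_le_exp\<close> times the root of 4,
    \<open>exp U\<close> accounts for the two values of \<open>u\<close> in \<open>X k\<close>, and
    the 2 is that of \<open>gauss_weight_le\<close>. Neither \<open>t\<close> nor \<open>s\<close>
    enters.\<close>
  define K where "K = 64 * exp U * 2 * (\<Sum>k. (real k + 1) powr (- 3 / 2))"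
  have main: "summable (\<lambda>k. gauss_weight s k * (real k + 1 + s) powr t * exp (t * u (gauss_branch k s))) \<and>
    (\<Sum>k. gauss_weight s k * (real k + 1 + s) powr t * exp (t * u (gauss_branch k s)))
      \<le> exp (t * L + \<bar>t\<bar> * \<epsilon> + t\<^sup>2 * K) * exp (t * u s)"
    if t: "\<bar>t\<bar> \<le> 1 / 4" and s: "s \<in> {0..1}" for t s
  proof -
    have s0: "s \<ge> 0" using s by simp
    define X where "X = (\<lambda>k. - ln (gauss_branch k s) + u (gauss_branch k s) - u s)"
    have term_eq: "gauss_weight s k * (real k + 1 + s) powr t * exp (t * u (gauss_branch k s))
        = gauss_weight s k * exp (t * X k) * exp (t * u s)" for k
    proof -
      have "(real k + 1 + s) powr t = exp (t * - ln (gauss_branch k s))"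
        using s0 by (simp add: powr_def gauss_branch_def ln_div)
      then show ?thesis by (simp add: X_def exp_add[symmetric] algebra_simps)
    qed
    have Xsums: "(\<lambda>k. gauss_weight s k * X k) sums (gauss_op (\<lambda>x. - ln x) s + gauss_op u s - 1 * u s)"
    proof -
      have "(\<lambda>k. gauss_weight s k * - ln (gauss_branch k s) + gauss_weight s k * u (gauss_branch k s)
          - gauss_weight s k * u s) sums (gauss_op (\<lambda>x. - ln x) s + gauss_op u s - 1 * u s)"
        unfolding gauss_op_def
        by (intro sums_diff sums_add sums_mult2 gauss_weight_sums[OF s0] summable_sums
            gauss_op_neg_ln_summable[OF s] gauss_weight_summable[OF s]) (rule u)
      then show ?thesis by (simp add: X_def algebra_simps)
    qed
    have bound: "exp (t * X k) \<le> 1 + t * X k + t\<^sup>2 * (64 * exp U * (real k + 1) powr (1 / 2))" for k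
    proof -
      have "exp (t * X k) \<le> 1 + t * X k + (t * X k)\<^sup>2 * exp \<bar>t * X k\<bar>" by (rule exp_le_quadratic)
      also have "(t * X k)\<^sup>2 * exp \<bar>t * X k\<bar> \<le> (t\<^sup>2 * (32 * exp (\<bar>X k\<bar> / 4))) * exp (\<bar>X k\<bar> / 4)"
      proof (intro mult_mono)
        show "(t * X k)\<^sup>2 \<le> t\<^sup>2 * (32 * exp (\<bar>X k\<bar> / 4))"
          unfolding power_mult_distrib by (intro mult_left_mono square_le_exp) auto
        have "\<bar>t * X k\<bar> \<le> 1 / 4 * \<bar>X k\<bar>" unfolding abs_mult using t by (intro mult_right_mono) auto
        then show "exp \<bar>t * X k\<bar> \<le> exp (\<bar>X k\<bar> / 4)" by simp
      qed auto
      also have "\<dots> = t\<^sup>2 * (32 * exp (\<bar>X k\<bar> / 2))" by (simp add: exp_add[symmetric])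
      also have "\<dots> \<le> t\<^sup>2 * (64 * exp U * (real k + 1) powr (1 / 2))"
      proof (intro mult_left_mono)
        have "- ln (gauss_branch k s) = ln (real k + 1 + s)" "ln (real k + 1 + s) \<ge> 0"
          using s by (auto simp: gauss_branch_def ln_div)
        then have "\<bar>X k\<bar> \<le> ln (real k + 1 + s) + 2 * U"
          using u[OF s] u[OF gauss_branch_bounds(1)[OF s0, of k]] unfolding X_def by linarith
        also have "ln (real k + 1 + s) \<le> ln (4 * (real k + 1))" using s by (intro ln_mono) auto
        finally have "exp (\<bar>X k\<bar> / 2) \<le> exp (ln (4 * (real k + 1)) / 2 + U)" by simp
        also have "\<dots> = exp U * (4 * (real k + 1)) powr (1 / 2)"
          by (simp add: exp_add powr_def)
        also have "(4 * (real k + 1)) powr (1 / 2) = 2 * (real k + 1) powr (1 / 2)"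
          by (subst powr_mult) (auto simp: powr_half_sqrt)
        finally show "32 * exp (\<bar>X k\<bar> / 2) \<le> 64 * exp U * (real k + 1) powr (1 / 2)" by simp
      qed simp
      finally show ?thesis by simp
    qed
    define b where "b = (\<lambda>k. gauss_weight s k + t * (gauss_weight s k * X k) + t\<^sup>2 * (64 * exp U * 2 * (real k + 1) powr (- 3 / 2)))"
    have b: "b sums (1 + t * (gauss_op (\<lambda>x. - ln x) s + gauss_op u s - 1 * u s) + t\<^sup>2 * K)"
      unfolding b_def K_def
      by (intro sums_add sums_mult gauss_weight_sums[OF s0] Xsums summable_sums summable_gauss_tail)
    have le: "gauss_weight s k * exp (t * X k) \<le> b k" for k
    proof -
      have "gauss_weight s k * exp (t * X k) \<le>
          gauss_weight s k * (1 + t * X k + t\<^sup>2 * (64 * exp U * (real k + 1) powr (1 / 2)))"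
        by (intro mult_left_mono bound gauss_weight_nonneg s0)
      also have "\<dots> = gauss_weight s k + t * (gauss_weight s k * X k) +
          gauss_weight s k * (t\<^sup>2 * (64 * exp U * (real k + 1) powr (1 / 2)))" by (simp add: algebra_simps)
      also have "gauss_weight s k * (t\<^sup>2 * (64 * exp U * (real k + 1) powr (1 / 2))) \<le>
          2 / (real k + 1)\<^sup>2 * (t\<^sup>2 * (64 * exp U * (real k + 1) powr (1 / 2)))"
        by (intro mult_right_mono gauss_weight_le[OF s]) auto
      also have "\<dots> = t\<^sup>2 * (64 * exp U * 2 * (1 / (real k + 1)\<^sup>2 * (real k + 1) powr (1 / 2)))" by simp
      finally show ?thesis unfolding square_root_tail b_def by simp
    qed
    have sm: "summable (\<lambda>k. gauss_weight s k * exp (t * X k))"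
    proof (rule summable_comparison_test'[OF sums_summable[OF b]])
      show "norm (gauss_weight s k * exp (t * X k)) \<le> b k" for k
        using le[of k] gauss_weight_nonneg[OF s0, of k] by simp
    qed
    have "(\<Sum>k. gauss_weight s k * exp (t * X k)) \<le> 1 + t * (gauss_op (\<lambda>x. - ln x) s + gauss_op u s - 1 * u s) + t\<^sup>2 * K"
      using suminf_le[OF le sm sums_summable[OF b]] sums_unique[OF b] by simp
    also have "\<dots> \<le> 1 + (t * L + \<bar>t\<bar> * \<epsilon>) + t\<^sup>2 * K"
    proof -
      let ?D = "gauss_op (\<lambda>x. - ln x) s + gauss_op u s - u s - L"
      have "t * ?D \<le> \<bar>t\<bar> * \<bar>?D\<bar>" by (metis abs_ge_self abs_mult)
      also have "\<dots> \<le> \<bar>t\<bar> * \<epsilon>" using mean[OF s] by (intro mult_left_mono) auto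
      finally show ?thesis by (simp add: algebra_simps)
    qed
    also have "\<dots> \<le> exp (t * L + \<bar>t\<bar> * \<epsilon> + t\<^sup>2 * K)"
      using exp_ge_add_one_self[of "t * L + \<bar>t\<bar> * \<epsilon> + t\<^sup>2 * K"] by (simp only: add.assoc)
    finally have total: "(\<Sum>k. gauss_weight s k * exp (t * X k)) \<le> exp (t * L + \<bar>t\<bar> * \<epsilon> + t\<^sup>2 * K)" .
    have "(\<lambda>k. gauss_weight s k * exp (t * X k) * exp (t * u s)) sums
        ((\<Sum>k. gauss_weight s k * exp (t * X k)) * exp (t * u s))"
      by (intro sums_mult2 summable_sums sm)
    moreover have "(\<Sum>k. gauss_weight s k * exp (t * X k)) * exp (t * u s)
        \<le> exp (t * L + \<bar>t\<bar> * \<epsilon> + t\<^sup>2 * K) * exp (t * u s)"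
      using total by (intro mult_right_mono) auto
    ultimately show ?thesis unfolding term_eq by (simp add: sums_iff)
  qed
  then show ?thesis by blast
qed

section \<open>Approximation by continued fractions\<close>

text \<open>A recursion along the Gauss map in place of a list of partial quotients, since the
  substitution \<open>z = gauss_branch k y\<close> acts directly on it. Division by 0 behaves alike
  in both forms, so they agree at every real.\<close>

fun cf_approx :: "nat \<Rightarrow> real \<Rightarrow> real" where
  "cf_approx 0 z = 0"
| "cf_approx (Suc n) z = 1 / (of_int \<lfloor>1 / z\<rfloor> + cf_approx n (gauss_map z))"

lemma of_rat_cf_value: "of_rat (cf_value n x) = cf_approx n x"
proof (induction n arbitrary: x)
  case (Suc n)
  have "map (\<lambda>i. partial_quotient i x) [1..<Suc (Suc n)] =
      partial_quotient 1 x # map (\<lambda>i. partial_quotient i x) [Suc 1..<Suc (Suc n)]"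
    by (subst upt_conv_Cons) auto
  also have "map (\<lambda>i. partial_quotient i x) [Suc 1..<Suc (Suc n)]
      = map (\<lambda>i. partial_quotient (Suc i) x) [1..<Suc n]"
    unfolding map_Suc_upt[symmetric] by simp
  also have "\<dots> = map (\<lambda>i. partial_quotient i (gauss_map x)) [1..<Suc n]"
  proof (rule map_cong[OF refl])
    fix i assume "i \<in> set [1..<Suc n]"
    \<comment> \<open>The shift holds from index 1 on: \<open>partial_quotient 0\<close> coincides
      with \<open>partial_quotient 1\<close>.\<close>
    then obtain j where "i = Suc j" using not0_implies_Suc[of i] by auto
    then show "partial_quotient (Suc i) x = partial_quotient i (gauss_map x)"
      by (simp add: partial_quotient_def funpow_swap1)
  qed
  finally have "cf_value (Suc n) x = 1 / (of_int (partial_quotient 1 x) + cf_value n (gauss_map x))"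
    unfolding cf_value_def by simp
  then show ?case using Suc by (simp add: of_rat_divide of_rat_add partial_quotient_def)
qed (simp add: cf_value_def)

lemma gauss_map_measurable [measurable]: "gauss_map \<in> borel_measurable borel"
proof -
  have eq: "gauss_map = (\<lambda>x. if x = 0 then 0 else 1 / x - of_int \<lfloor>1 / x\<rfloor>)"
    by (rule ext) (simp add: gauss_map_def)
  show ?thesis unfolding eq by measurable
qed

lemma cf_approx_measurable [measurable]: "cf_approx n \<in> borel_measurable borel"
proof (induction n)
  case (Suc n)
  note Suc [measurable]
  have "cf_approx (Suc n) = (\<lambda>z. 1 / (of_int \<lfloor>1 / z\<rfloor> + cf_approx n (gauss_map z)))"
    by (rule ext) simp
  then show ?case by (simp only:) measurable
qed simp

lemma gauss_map_nonneg: "gauss_map z \<ge> 0"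
proof (cases "z = 0")
  case False
  then show ?thesis
    unfolding gauss_map_def using of_int_floor_le[of "1 / z"] by (simp only: if_False diff_ge_0_iff_ge)
qed (simp add: gauss_map_def)

lemma cf_approx_nonneg: "z \<ge> 0 \<Longrightarrow> cf_approx n z \<ge> 0"
proof (induction n arbitrary: z)
  case (Suc n)
  then have "0 \<le> 1 / z" by simp
  then have "0 \<le> real_of_int \<lfloor>1 / z\<rfloor>" by (intro of_int_nonneg) (simp only: zero_le_floor)
  moreover have "0 \<le> cf_approx n (gauss_map z)" by (intro Suc.IH gauss_map_nonneg)
  ultimately show ?case unfolding cf_approx.simps by (intro divide_nonneg_nonneg add_nonneg_nonneg) auto
qed simp

lemma
  assumes "0 < y" "y < 1"
  shows floor_gauss_branch: "\<lfloor>1 / gauss_branch k y\<rfloor> = int k + 1"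
    and gauss_map_branch: "gauss_map (gauss_branch k y) = y"
proof -
  show fl: "\<lfloor>1 / gauss_branch k y\<rfloor> = int k + 1"
    using assms by (simp add: gauss_branch_def floor_eq_iff)
  show "gauss_map (gauss_branch k y) = y"
    using gauss_branch_bounds(2)[of y k] assms unfolding gauss_map_def fl
    by (simp add: gauss_branch_def)
qed

text \<open>
  If \<open>x = (p\<^sub>m + z p\<^sub>m\<^sub>-\<^sub>1) / (q\<^sub>m + z q\<^sub>m\<^sub>-\<^sub>1)\<close> and \<open>s = q\<^sub>m\<^sub>-\<^sub>1 / q\<^sub>m\<close>, then \<open>q\<^sub>m\<^sup>2 \<bar>x - p\<^sub>m\<^sub>+\<^sub>n / q\<^sub>m\<^sub>+\<^sub>n\<bar>\<close> is
  \<open>cf_error n s z\<close>, and \<open>cf_density s\<close> is the density of \<open>z\<close> conditional on the first \<open>m\<close> partial quotients.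
\<close>

definition cf_error :: "nat \<Rightarrow> real \<Rightarrow> real \<Rightarrow> real" where
  "cf_error n s z = \<bar>z - cf_approx n z\<bar> / ((1 + s * z) * (1 + s * cf_approx n z))"

definition cf_density :: "real \<Rightarrow> real \<Rightarrow> real" where
  "cf_density s z = (1 + s) / (1 + s * z)\<^sup>2"

lemma cf_error_measurable [measurable]: "cf_error n s \<in> borel_measurable borel"
  unfolding cf_error_def[abs_def] by measurable

lemma cf_density_measurable [measurable]: "cf_density s \<in> borel_measurable borel"
  unfolding cf_density_def[abs_def] by measurable

lemma cf_density_nonneg: "s \<ge> 0 \<Longrightarrow> cf_density s z \<ge> 0"
  unfolding cf_density_def by simp

text \<open>Reading the partial quotient \<open>k + 1\<close> leaves the error itself unchanged and
  turns \<open>q_m\<close> into \<open>q_m / gauss_branch k s\<close>, so the normalisation by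
  \<open>q_m^2\<close> changes by the square.\<close>

lemma cf_error_branch:
  assumes s: "s \<ge> 0" and y: "0 < y" "y < 1"
  shows "cf_error (Suc n) s (gauss_branch k y) = cf_error n (gauss_branch k s) y * (gauss_branch k s)\<^sup>2"
proof -
  define a where "a = real k + 1"
  define c where "c = cf_approx n y"
  have a: "a > 0" and c: "c \<ge> 0" using cf_approx_nonneg[of y n] y by (auto simp: a_def c_def)
  have nz: "a + y > 0" "a + c > 0" "a + s > 0" "a + y + s > 0" "a + c + s > 0" using a c s y by auto
  have ap: "cf_approx (Suc n) (gauss_branch k y) = 1 / (a + c)"
    using floor_gauss_branch[OF y, of k] gauss_map_branch[OF y, of k] by (simp add: a_def c_def)
  have br: "gauss_branch k y = 1 / (a + y)" "gauss_branch k s = 1 / (a + s)"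
    by (simp_all add: gauss_branch_def a_def)
  have "\<bar>1 / (a + y) - 1 / (a + c)\<bar> = \<bar>y - c\<bar> / ((a + y) * (a + c))"
    using nz by (simp add: diff_frac_eq abs_mult abs_minus_commute)
  moreover have "1 + s * (1 / (a + y)) = (a + y + s) / (a + y)" "1 + s * (1 / (a + c)) = (a + c + s) / (a + c)"
    "1 + 1 / (a + s) * y = (a + y + s) / (a + s)" "1 + 1 / (a + s) * c = (a + c + s) / (a + s)"
    using nz by (auto simp: field_simps)
  ultimately show ?thesis
    unfolding cf_error_def ap unfolding br c_def[symmetric]
    using nz by (simp add: power2_eq_square)
qed

text \<open>The Markov property: the joint density of the next branch and the remainder
  \<open>y\<close> is the transition weight times the conditional density from the new
  ratio.\<close>

lemma cf_density_branch:
  assumes s: "s \<ge> 0" and y: "0 < y"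
  shows "cf_density s (gauss_branch k y) * (gauss_branch k y)\<^sup>2 = gauss_weight s k * cf_density (gauss_branch k s) y"
proof -
  define a where "a = real k + 1"
  have nz: "a + y > 0" "a + s > 0" "a + y + s > 0" "a + 1 + s > 0" using s y by (auto simp: a_def)
  have br: "gauss_branch k y = 1 / (a + y)" "gauss_branch k s = 1 / (a + s)"
    by (simp_all add: gauss_branch_def a_def)
  have w: "gauss_weight s k = (1 + s) / ((a + s) * (a + 1 + s))"
    by (simp add: gauss_weight_def a_def add.assoc)
  have e: "1 + s * (1 / (a + y)) = (a + y + s) / (a + y)" "1 + 1 / (a + s) * y = (a + y + s) / (a + s)"
    "1 + 1 / (a + s) = (a + 1 + s) / (a + s)"
    using nz by (auto simp: field_simps)
  show ?thesis unfolding cf_density_def br w unfolding e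
    using nz by (simp add: power2_eq_square)
qed

section \<open>Moments of the approximation error\<close>

lemma inverse_sqrt_integral:
  "(\<integral>\<^sup>+z. ennreal (z powr (- 1 / 2)) * indicator {0<..<1} z \<partial>lborel) \<le> ennreal 2"
proof -
  have "((\<lambda>x. x powr (- 1 / 2)) has_integral (1 powr (- 1 / 2 + 1) / (- 1 / 2 + 1))) {0..1::real}"
    by (rule has_integral_powr_from_0) auto
  then have "((\<lambda>x. x powr (- 1 / 2)) has_integral 2) {0..1::real}" by simp
  then have "(\<integral>\<^sup>+x. ennreal (indicator {0..1} x * x powr (- 1 / 2)) \<partial>lborel) = ennreal 2"
    by (intro nn_integral_has_integral_lebesgue) auto
  moreover have "(\<integral>\<^sup>+z. ennreal (z powr (- 1 / 2)) * indicator {0<..<1} z \<partial>lborel) \<le>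
      (\<integral>\<^sup>+x. ennreal (indicator {0..1} x * x powr (- 1 / 2)) \<partial>lborel)"
    by (intro nn_integral_mono) (auto simp: indicator_def)
  ultimately show ?thesis by simp
qed

text \<open>For \<open>n = 0\<close> the error is \<open>z / (1 + s z)\<close>, between
  \<open>z / 2\<close> and 1, so the worst exponent is -1/2. The 8 collects 2 for the density, 2 for
  the halved argument and 2 for the integral of \<open>z powr (- 1 / 2)\<close>.\<close>

lemma cf_moment_0:
  assumes s: "s \<in> {0..1}" and t: "\<bar>t\<bar> \<le> 1"
  shows "(\<integral>\<^sup>+z. ennreal (cf_density s z * cf_error 0 s z powr (- t / 2)) * indicator {0<..<1} z \<partial>lborel) \<le> ennreal 8"
proof -
  have le: "cf_density s z * cf_error 0 s z powr (- t / 2) \<le> 4 * z powr (- 1 / 2)" if z: "0 < z" "z < 1" for z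
  proof -
    have sz: "0 \<le> s * z" "s * z \<le> 1" using s z mult_mono[of s 1 z 1] by auto
    have err: "cf_error 0 s z = z / (1 + s * z)" using z by (simp add: cf_error_def)
    have b: "z / 2 \<le> z / (1 + s * z)" "z / (1 + s * z) \<le> z / 1"
      using sz z by (intro divide_left_mono; auto)+
    have "(z / (1 + s * z)) powr (- t / 2) \<le> 2 * z powr (- 1 / 2)"
    proof -
      have pos: "0 < z / (1 + s * z)" using z sz by (intro divide_pos_pos) auto
      have "(z / (1 + s * z)) powr (- t / 2) \<le> (z / (1 + s * z)) powr (- 1 / 2)"
        using t z b pos by (intro powr_mono') auto
      also have "\<dots> \<le> (z / 2) powr (- 1 / 2)"
        using z b by (intro powr_mono2') auto
      also have "\<dots> = z powr (- 1 / 2) / 2 powr (- 1 / 2)" using z by (simp add: powr_divide)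
      also have "(2::real) powr (- 1 / 2) = 1 / sqrt 2"
        using powr_minus_divide[of "2::real" "1 / 2"] powr_half_sqrt[of "2::real"] by simp
      also have "z powr (- 1 / 2) / (1 / sqrt 2) = z powr (- 1 / 2) * sqrt 2" by simp
      also have "\<dots> \<le> z powr (- 1 / 2) * 2" using sqrt2_less_2 by (intro mult_left_mono) auto
      finally show ?thesis by simp
    qed
    moreover have "cf_density s z \<le> 2 / 1\<^sup>2"
      unfolding cf_density_def using s sz by (intro frac_le power_mono) auto
    ultimately have "cf_density s z * cf_error 0 s z powr (- t / 2) \<le> 2 * (2 * z powr (- 1 / 2))"
      unfolding err using s by (intro mult_mono) (auto intro: cf_density_nonneg)
    then show ?thesis by simp
  qed
  have "(\<integral>\<^sup>+z. ennreal (cf_density s z * cf_error 0 s z powr (- t / 2)) * indicator {0<..<1} z \<partial>lborel)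
      \<le> (\<integral>\<^sup>+z. ennreal 4 * (ennreal (z powr (- 1 / 2)) * indicator {0<..<1} z) \<partial>lborel)"
  proof (intro nn_integral_mono)
    fix z :: real
    show "ennreal (cf_density s z * cf_error 0 s z powr (- t / 2)) * indicator {0<..<1} z \<le>
      ennreal 4 * (ennreal (z powr (- 1 / 2)) * indicator {0<..<1} z)"
    proof (cases "z \<in> {0<..<1}")
      case True
      then show ?thesis using le[of z] by (simp only: ennreal_mult'[symmetric] indicator_simps mult_1_right) (auto intro!: ennreal_leI)
    qed simp
  qed
  also have "\<dots> = ennreal 4 * (\<integral>\<^sup>+z. ennreal (z powr (- 1 / 2)) * indicator {0<..<1} z \<partial>lborel)"
    by (rule nn_integral_cmult) measurable
  also have "\<dots> \<le> ennreal 4 * ennreal 2" by (intro mult_left_mono inverse_sqrt_integral) auto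
  also have "\<dots> = ennreal 8" by (simp add: ennreal_mult[symmetric])
  finally show ?thesis .
qed

lemma cf_moment_Suc:
  assumes s: "s \<ge> 0"
  shows "(\<integral>\<^sup>+z. ennreal (cf_density s z * cf_error (Suc n) s z powr (- t / 2)) * indicator {0<..<1} z \<partial>lborel) =
    (\<Sum>k. ennreal (gauss_weight s k * (real k + 1 + s) powr t) *
      (\<integral>\<^sup>+z. ennreal (cf_density (gauss_branch k s) z * cf_error n (gauss_branch k s) z powr (- t / 2)) * indicator {0<..<1} z \<partial>lborel))"
proof -
  have "(\<integral>\<^sup>+z. ennreal (cf_density s z * cf_error (Suc n) s z powr (- t / 2)) * indicator {0<..<1} z \<partial>lborel) =
    (\<Sum>k. \<integral>\<^sup>+y. ennreal (cf_density s (gauss_branch k y) * cf_error (Suc n) s (gauss_branch k y) powr (- t / 2))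
       * ennreal ((gauss_branch k y)\<^sup>2) * indicator {0<..<1} y \<partial>lborel)"
    by (rule nn_integral_gauss) measurable
  also have "\<dots> = (\<Sum>k. \<integral>\<^sup>+y. ennreal (gauss_weight s k * (real k + 1 + s) powr t) *
      (ennreal (cf_density (gauss_branch k s) y * cf_error n (gauss_branch k s) y powr (- t / 2)) * indicator {0<..<1} y) \<partial>lborel)"
  proof (intro suminf_cong nn_integral_cong)
    fix k and y :: real
    show "ennreal (cf_density s (gauss_branch k y) * cf_error (Suc n) s (gauss_branch k y) powr (- t / 2))
       * ennreal ((gauss_branch k y)\<^sup>2) * indicator {0<..<1} y =
      ennreal (gauss_weight s k * (real k + 1 + s) powr t) *
      (ennreal (cf_density (gauss_branch k s) y * cf_error n (gauss_branch k s) y powr (- t / 2)) * indicator {0<..<1} y)"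
    proof (cases "y \<in> {0<..<1}")
      case True
      then have y: "0 < y" "y < 1" by auto
      have p: "real k + 1 + s > 0" using s by simp
      have b2: "(gauss_branch k s)\<^sup>2 powr (- t / 2) = (real k + 1 + s) powr t"
      proof -
        have "(gauss_branch k s)\<^sup>2 = (real k + 1 + s) powr (- 2)"
          using p by (simp add: gauss_branch_def powr_minus powr_numeral power_one_over divide_inverse power_inverse)
        then show ?thesis by (simp add: powr_powr)
      qed
      have "cf_error (Suc n) s (gauss_branch k y) powr (- t / 2)
          = cf_error n (gauss_branch k s) y powr (- t / 2) * (real k + 1 + s) powr t"
        unfolding cf_error_branch[OF s y] b2[symmetric]
        by (rule powr_mult)
      then have "cf_density s (gauss_branch k y) * cf_error (Suc n) s (gauss_branch k y) powr (- t / 2) * (gauss_branch k y)\<^sup>2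
        = (cf_density s (gauss_branch k y) * (gauss_branch k y)\<^sup>2) *
           (cf_error n (gauss_branch k s) y powr (- t / 2) * (real k + 1 + s) powr t)" by simp
      also have "\<dots> = gauss_weight s k * (real k + 1 + s) powr t *
          (cf_density (gauss_branch k s) y * cf_error n (gauss_branch k s) y powr (- t / 2))"
        unfolding cf_density_branch[OF s y(1)] by simp
      finally show ?thesis
        using True gauss_weight_nonneg[OF s, of k]
        by (simp add: ennreal_mult'[symmetric] ennreal_mult''[symmetric])
    qed simp
  qed
  also have "\<dots> = (\<Sum>k. ennreal (gauss_weight s k * (real k + 1 + s) powr t) *
      (\<integral>\<^sup>+z. ennreal (cf_density (gauss_branch k s) z * cf_error n (gauss_branch k s) z powr (- t / 2)) * indicator {0<..<1} z \<partial>lborel))"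
    by (intro suminf_cong nn_integral_cmult) measurable
  finally show ?thesis .
qed

text \<open>One step of \<open>cf_moment_Suc\<close> maps \<open>exp (t * u)\<close> to at most
  \<open>R\<close> times itself, so the induction must run over all \<open>s\<close>. The factor
  \<open>exp U\<close> makes the claim hold at \<open>n = 0\<close>, where
  \<open>exp (t * u s) >= exp (- U)\<close>.\<close>

lemma cf_moment:
  assumes u: "\<And>x. x \<in> {0..1} \<Longrightarrow> \<bar>u x\<bar> \<le> U" and t: "\<bar>t\<bar> \<le> 1"
    and step: "\<And>s. s \<in> {0..1} \<Longrightarrow>
      summable (\<lambda>k. gauss_weight s k * (real k + 1 + s) powr t * exp (t * u (gauss_branch k s))) \<and>
      (\<Sum>k. gauss_weight s k * (real k + 1 + s) powr t * exp (t * u (gauss_branch k s))) \<le> R * exp (t * u s)"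
    and s: "s \<in> {0..1}" and R: "R \<ge> 0"
  shows "(\<integral>\<^sup>+z. ennreal (cf_density s z * cf_error n s z powr (- t / 2)) * indicator {0<..<1} z \<partial>lborel)
    \<le> ennreal (8 * exp U * R ^ n * exp (t * u s))"
  using s
proof (induction n arbitrary: s)
  case 0
  have "\<bar>t * u s\<bar> \<le> 1 * U" unfolding abs_mult using t u[OF 0] by (intro mult_mono) auto
  then have "exp (- U) \<le> exp (t * u s)" by simp
  then have "exp U * exp (- U) \<le> exp U * exp (t * u s)" by (intro mult_left_mono) auto
  then have "8 \<le> 8 * exp U * R ^ 0 * exp (t * u s)" by (simp add: exp_add[symmetric])
  then show ?case using cf_moment_0[OF 0 t] by (meson ennreal_leI order_trans)
next
  case (Suc n)
  then have s0: "s \<ge> 0" by simp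
  let ?C = "8 * exp U * R ^ n"
  let ?w = "\<lambda>k. gauss_weight s k * (real k + 1 + s) powr t"
  have w: "?w k \<ge> 0" for k using gauss_weight_nonneg[OF s0, of k] by simp
  have C: "?C \<ge> 0" using R by simp
  have "(\<integral>\<^sup>+z. ennreal (cf_density s z * cf_error (Suc n) s z powr (- t / 2)) * indicator {0<..<1} z \<partial>lborel)
     \<le> (\<Sum>k. ennreal (?w k) * ennreal (?C * exp (t * u (gauss_branch k s))))"
    unfolding cf_moment_Suc[OF s0]
    by (intro suminf_le mult_left_mono Suc.IH gauss_branch_bounds s0) auto
  also have "\<dots> = (\<Sum>k. ennreal (?C * (?w k * exp (t * u (gauss_branch k s)))))"
    using w C by (intro suminf_cong) (simp add: ennreal_mult'[symmetric] algebra_simps)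
  also have "\<dots> = ennreal (\<Sum>k. ?C * (?w k * exp (t * u (gauss_branch k s))))"
  proof (rule suminf_ennreal2)
    show "summable (\<lambda>k. ?C * (?w k * exp (t * u (gauss_branch k s))))"
      using step[OF Suc.prems] by (intro summable_mult) auto
    show "0 \<le> ?C * (?w k * exp (t * u (gauss_branch k s)))" for k
      using C w[of k] by (intro mult_nonneg_nonneg[OF C] mult_nonneg_nonneg[OF w]) auto
  qed
  also have "(\<Sum>k. ?C * (?w k * exp (t * u (gauss_branch k s)))) = ?C * (\<Sum>k. ?w k * exp (t * u (gauss_branch k s)))"
    using step[OF Suc.prems] by (intro suminf_mult) auto
  also have "\<dots> \<le> ?C * (R * exp (t * u s))"
    using step[OF Suc.prems] C by (intro mult_left_mono) auto
  also have "?C * (R * exp (t * u s)) = 8 * exp U * R ^ Suc n * exp (t * u s)" by simp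
  finally show ?case by (simp add: ennreal_leI)
qed

section \<open>Beta expansions\<close>

lemma beta_map_measurable [measurable]: "beta_map \<beta> \<in> borel_measurable borel"
proof -
  have eq: "beta_map \<beta> = (\<lambda>x. \<beta> * x - of_int \<lfloor>\<beta> * x\<rfloor>)"
    by (rule ext) (simp add: beta_map_def)
  show ?thesis unfolding eq by measurable
qed

lemma beta_map_funpow_measurable [measurable]: "(beta_map \<beta> ^^ n) \<in> borel_measurable borel"
proof (induction n)
  case (Suc n)
  note Suc [measurable]
  show ?case by (simp add: comp_def)
qed (simp add: id_def)

lemma beta_map_bounds: "beta_map \<beta> x \<in> {0..<1}"
  using frac_ge_0[of "\<beta> * x"] frac_lt_1[of "\<beta> * x"] by (simp add: beta_map_def frac_def)

lemma beta_remainder: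
  assumes "\<beta> \<noteq> 0"
  shows "x - beta_convergent \<beta> n x = (beta_map \<beta> ^^ n) x / \<beta> ^ n"
proof (induction n)
  case (Suc n)
  let ?y = "(beta_map \<beta> ^^ n) x"
  have "x - beta_convergent \<beta> (Suc n) x = ?y / \<beta> ^ n - of_int \<lfloor>\<beta> * ?y\<rfloor> / \<beta> ^ Suc n"
    using Suc by (simp add: beta_convergent_def beta_digit_def)
  also have "\<dots> = (\<beta> * ?y - of_int \<lfloor>\<beta> * ?y\<rfloor>) / \<beta> ^ Suc n"
    using assms by (simp add: diff_divide_distrib)
  finally show ?case by (simp add: beta_map_def[of _ ?y])
qed (simp add: beta_convergent_def)

lemma emeasure_affine_vimage:
  fixes A :: "real set"
  assumes [measurable]: "A \<in> sets borel" and c: "c > 0"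
  shows "emeasure lborel {y. c * y - d \<in> A} = ennreal (1 / c) * emeasure lborel A"
proof -
  have "emeasure lborel A = (\<integral>\<^sup>+x. indicator A x \<partial>lborel)" by simp
  also have "\<dots> = ennreal \<bar>c\<bar> * (\<integral>\<^sup>+x. indicator A (- d + c * x) \<partial>lborel)"
    using c by (intro nn_integral_real_affine) auto
  also have "(\<integral>\<^sup>+x. indicator A (- d + c * x) \<partial>lborel) = (\<integral>\<^sup>+x. indicator {y. c * y - d \<in> A} x \<partial>lborel)"
    by (intro nn_integral_cong) (auto simp: indicator_def)
  also have "\<dots> = emeasure lborel {y. c * y - d \<in> A}" by (rule nn_integral_indicator) measurable
  finally have "ennreal (1 / c) * emeasure lborel A
      = (ennreal (1 / c) * ennreal \<bar>c\<bar>) * emeasure lborel {y. c * y - d \<in> A}"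
    by (simp add: mult.assoc)
  also have "ennreal (1 / c) * ennreal \<bar>c\<bar> = 1" using c by (simp add: ennreal_mult[symmetric])
  finally show ?thesis by simp
qed

text \<open>The last branch of \<open>beta_map\<close> is in general incomplete, so preimages within
  the unit interval lead to shorter intervals; hence the induction over all \<open>r\<close>. At
  each step the full branches turn \<open>\<delta> * (1 / \<beta>) ^ n\<close> into a new term of
  the sum, and the incomplete one hands it on divided by \<beta>.\<close>

lemma emeasure_beta_map_less:
  assumes \<beta>: "\<beta> > 1" and \<delta>: "\<delta> \<ge> 0" and r: "0 \<le> r" "r \<le> 1"
  shows "emeasure lborel {y \<in> {0..<r}. (beta_map \<beta> ^^ n) y < \<delta>}
    \<le> ennreal (r * \<delta> * (\<Sum>k<n. (1 / \<beta>) ^ k) + \<delta> * (1 / \<beta>) ^ n)"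
  using r
proof (induction n arbitrary: r)
  case 0
  have "emeasure lborel {y \<in> {0..<r}. (beta_map \<beta> ^^ 0) y < \<delta>} \<le> emeasure lborel {0..<\<delta>}"
    by (intro emeasure_mono) auto
  then show ?case using \<delta> by simp
next
  case (Suc n)
  \<comment> \<open>\<open>J\<close> counts the branches complete on \<open>[0, r)\<close>; the
    remaining one is mapped onto \<open>[0, f)\<close>. Thus
    \<open>(J + f) / \<beta> = r\<close>.\<close>
  define J where "J = nat \<lfloor>\<beta> * r\<rfloor>"
  define f where "f = \<beta> * r - real J"
  have br: "0 \<le> \<beta> * r" using \<beta> Suc.prems by simp
  then have J: "real J = of_int \<lfloor>\<beta> * r\<rfloor>" by (simp add: J_def)
  have f: "0 \<le> f" "f \<le> 1" "real J \<le> \<beta> * r" unfolding f_def J by linarith+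
  define A where "A = (\<lambda>q. {y \<in> {0..<q}. (beta_map \<beta> ^^ n) y < \<delta>})"
  have A [measurable]: "A q \<in> sets borel" for q unfolding A_def by measurable
  let ?S = "\<Sum>k<n. (1 / \<beta>) ^ k" and ?p = "(1 / \<beta>) ^ n"
  define h where "h = (\<lambda>q. q * \<delta> * ?S + \<delta> * ?p)"
  have h: "emeasure lborel (A q) \<le> ennreal (h q)" "0 \<le> h q" if "0 \<le> q" "q \<le> 1" for q
    using Suc.IH[OF that] that \<beta> \<delta> by (auto simp: A_def h_def intro!: add_nonneg_nonneg mult_nonneg_nonneg sum_nonneg)
  define V where "V = (\<lambda>d q. {y. \<beta> * y - d \<in> A q})"
  have V [measurable]: "V d q \<in> sets lborel" for d q unfolding V_def by measurable
  have Vm: "emeasure lborel (V d q) \<le> ennreal (1 / \<beta> * h q)" if "0 \<le> q" "q \<le> 1" for d q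
  proof -
    have "emeasure lborel (V d q) = ennreal (1 / \<beta>) * emeasure lborel (A q)"
      unfolding V_def using \<beta> by (intro emeasure_affine_vimage A) auto
    also have "\<dots> \<le> ennreal (1 / \<beta>) * ennreal (h q)" by (intro mult_left_mono h that) auto
    also have "\<dots> = ennreal (1 / \<beta> * h q)" using \<beta> by (subst ennreal_mult') auto
    finally show ?thesis .
  qed
  have sub: "{y \<in> {0..<r}. (beta_map \<beta> ^^ Suc n) y < \<delta>} \<subseteq> (\<Union>j<J. V (real j) 1) \<union> V (real J) f"
  proof
    fix y assume y: "y \<in> {y \<in> {0..<r}. (beta_map \<beta> ^^ Suc n) y < \<delta>}"
    define j where "j = nat \<lfloor>\<beta> * y\<rfloor>"
    have y0: "0 \<le> \<beta> * y" "\<beta> * y < \<beta> * r" using y \<beta> by auto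
    then have j: "real j = of_int \<lfloor>\<beta> * y\<rfloor>" by (simp add: j_def)
    have map: "beta_map \<beta> y = \<beta> * y - real j" unfolding beta_map_def j ..
    have "(beta_map \<beta> ^^ n) (\<beta> * y - real j) < \<delta>" using y unfolding map[symmetric] by (simp add: funpow_swap1)
    moreover have "\<beta> * y - real j \<in> {0..<1}" using beta_map_bounds[of \<beta> y] unfolding map .
    ultimately have in1: "y \<in> V (real j) 1" and inq: "\<And>q. \<beta> * y - real j < q \<Longrightarrow> y \<in> V (real j) q"
      by (auto simp: V_def A_def)
    have "j \<le> J" unfolding j_def J_def using y0 by (intro nat_mono floor_mono) auto
    then consider "j < J" | "j = J" by linarith
    then show "y \<in> (\<Union>j<J. V (real j) 1) \<union> V (real J) f"
    proof cases
      case 1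
      then show ?thesis using in1 by auto
    next
      case 2
      then show ?thesis using inq[of f] y0 by (simp add: f_def)
    qed
  qed
  have "emeasure lborel {y \<in> {0..<r}. (beta_map \<beta> ^^ Suc n) y < \<delta>} \<le>
      emeasure lborel ((\<Union>j<J. V (real j) 1) \<union> V (real J) f)"
    by (rule emeasure_mono[OF sub]) measurable
  also have "\<dots> \<le> emeasure lborel (\<Union>j<J. V (real j) 1) + emeasure lborel (V (real J) f)"
    by (rule emeasure_subadditive) measurable
  also have "\<dots> \<le> (\<Sum>j<J. emeasure lborel (V (real j) 1)) + emeasure lborel (V (real J) f)"
    by (intro add_right_mono emeasure_subadditive_finite) (use V in auto)
  also have "\<dots> \<le> (\<Sum>j<J. ennreal (1 / \<beta> * h 1)) + ennreal (1 / \<beta> * h f)"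
    by (intro add_mono sum_mono Vm f) auto
  also have "\<dots> = ennreal (real J * (1 / \<beta> * h 1) + 1 / \<beta> * h f)"
  proof -
    have "(\<Sum>j<J. ennreal x) + ennreal y = ennreal (real J * x + y)" if "x \<ge> 0" "y \<ge> 0" for x y
      using that by (simp add: ennreal_mult ennreal_of_nat_eq_real_of_nat)
    then show ?thesis using h(2)[of 1] h(2)[OF f(1,2)] \<beta> by (simp del: times_divide_eq_left)
  qed
  also have "\<dots> \<le> ennreal (r * \<delta> * (\<Sum>k<Suc n. (1 / \<beta>) ^ k) + \<delta> * (1 / \<beta>) ^ Suc n)"
  proof (rule ennreal_leI)
    have "real J * (1 / \<beta> * h 1) + 1 / \<beta> * h f =
        (real J + f) / \<beta> * (\<delta> * ?S) + real J / \<beta> * (\<delta> * ?p) + \<delta> * (?p / \<beta>)"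
      using \<beta> by (simp add: h_def field_simps)
    also have "(real J + f) / \<beta> = r" using \<beta> by (simp add: f_def)
    also have "real J / \<beta> * (\<delta> * ?p) \<le> r * (\<delta> * ?p)"
      using f(3) \<beta> \<delta> by (intro mult_right_mono) (auto simp: field_simps)
    finally show "real J * (1 / \<beta> * h 1) + 1 / \<beta> * h f
        \<le> r * \<delta> * (\<Sum>k<Suc n. (1 / \<beta>) ^ k) + \<delta> * (1 / \<beta>) ^ Suc n"
      by (simp add: algebra_simps)
  qed
  finally show ?case .
qed

text \<open>At \<open>r = 1\<close> the extra summand is just the next term of the geometric
  series.\<close>

lemma emeasure_beta_map_less_unit:
  assumes \<beta>: "\<beta> > 1" and \<delta>: "\<delta> \<ge> 0"
  shows "emeasure lborel {y \<in> {0..<1}. (beta_map \<beta> ^^ n) y < \<delta>} \<le> ennreal (\<beta> / (\<beta> - 1) * \<delta>)"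
proof -
  have "emeasure lborel {y \<in> {0..<1}. (beta_map \<beta> ^^ n) y < \<delta>}
      \<le> ennreal (1 * \<delta> * (\<Sum>k<n. (1 / \<beta>) ^ k) + \<delta> * (1 / \<beta>) ^ n)"
    by (rule emeasure_beta_map_less) (use assms in auto)
  also have "\<dots> \<le> ennreal (\<beta> / (\<beta> - 1) * \<delta>)"
  proof (rule ennreal_leI)
    have "(\<Sum>k<Suc n. (1 / \<beta>) ^ k) \<le> (\<Sum>k. (1 / \<beta>) ^ k)"
      using \<beta> by (intro sum_le_suminf summable_geometric) auto
    also have "\<dots> = \<beta> / (\<beta> - 1)" using \<beta> by (subst suminf_geometric) (auto simp: field_simps)
    finally have "\<delta> * (\<Sum>k<Suc n. (1 / \<beta>) ^ k) \<le> \<delta> * (\<beta> / (\<beta> - 1))" using \<delta> by (rule mult_left_mono)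
    then show "1 * \<delta> * (\<Sum>k<n. (1 / \<beta>) ^ k) + \<delta> * (1 / \<beta>) ^ n \<le> \<beta> / (\<beta> - 1) * \<delta>"
      by (simp add: algebra_simps)
  qed
  finally show ?thesis .
qed

section \<open>Large deviations\<close>

text \<open>At \<open>s = 0\<close> the density is 1 and \<open>cf_error\<close> is the plain error,
  so the moment bound concerns Lebesgue measure and Markov's inequality applies. For
  \<open>t > 0\<close> the event says that the error is nonzero and at most \<eta>, for
  \<open>t < 0\<close> that it is at least \<eta>. \<open>B\<close> and \<open>K\<close> are fixed
  before \<open>t\<close>, which is optimised later.\<close>

lemma cf_approx_chebyshev:
  assumes "\<epsilon> > 0"
  shows "\<exists>B>0. \<exists>K\<ge>0. \<forall>t n \<eta>. \<bar>t\<bar> \<le> 1 / 4 \<longrightarrow> \<eta> > 0 \<longrightarrow>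
    emeasure lborel {z \<in> {0<..<1}. 1 \<le> \<eta> powr (t / 2) * \<bar>z - cf_approx n z\<bar> powr (- t / 2)}
      \<le> ennreal (\<eta> powr (t / 2) * (B * exp (t * levy_const + \<bar>t\<bar> * \<epsilon> + t\<^sup>2 * K) ^ n))"
proof -
  obtain u U where u: "\<forall>x\<in>{0..1}. \<bar>u x\<bar> \<le> U"
    and mean: "\<forall>s\<in>{0..1}. \<bar>gauss_op (\<lambda>x. - ln x) s + gauss_op u s - u s - levy_const\<bar> \<le> \<epsilon>"
    using gauss_op_coboundary[OF assms] by blast
  have "\<exists>K. \<forall>t s. \<bar>t\<bar> \<le> 1 / 4 \<longrightarrow> s \<in> {0..1} \<longrightarrow>
    summable (\<lambda>k. gauss_weight s k * (real k + 1 + s) powr t * exp (t * u (gauss_branch k s))) \<and>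
    (\<Sum>k. gauss_weight s k * (real k + 1 + s) powr t * exp (t * u (gauss_branch k s)))
      \<le> exp (t * levy_const + \<bar>t\<bar> * \<epsilon> + t\<^sup>2 * K) * exp (t * u s)"
    by (rule gauss_exp_moment) (use u mean in auto)
  then obtain K where K: "\<And>t s. \<bar>t\<bar> \<le> 1 / 4 \<Longrightarrow> s \<in> {0..1} \<Longrightarrow>
    summable (\<lambda>k. gauss_weight s k * (real k + 1 + s) powr t * exp (t * u (gauss_branch k s))) \<and>
    (\<Sum>k. gauss_weight s k * (real k + 1 + s) powr t * exp (t * u (gauss_branch k s)))
      \<le> exp (t * levy_const + \<bar>t\<bar> * \<epsilon> + t\<^sup>2 * K) * exp (t * u s)"
    by blast
  \<comment> \<open>One \<open>exp U\<close> comes from \<open>cf_moment\<close>, the other bounds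
    \<open>exp (t * u 0)\<close>. \<open>K\<close> arrives without a sign and is replaced by its
    absolute value.\<close>
  let ?B = "8 * exp U * exp U"
  have "emeasure lborel {z \<in> {0<..<1}. 1 \<le> \<eta> powr (t / 2) * \<bar>z - cf_approx n z\<bar> powr (- t / 2)}
      \<le> ennreal (\<eta> powr (t / 2) * (?B * exp (t * levy_const + \<bar>t\<bar> * \<epsilon> + t\<^sup>2 * \<bar>K\<bar>) ^ n))"
    if t: "\<bar>t\<bar> \<le> 1 / 4" and \<eta>: "\<eta> > 0" for t n \<eta>
  proof -
    let ?R = "exp (t * levy_const + \<bar>t\<bar> * \<epsilon> + t\<^sup>2 * K)" and ?R' = "exp (t * levy_const + \<bar>t\<bar> * \<epsilon> + t\<^sup>2 * \<bar>K\<bar>)"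
    let ?h = "\<lambda>z. \<bar>z - cf_approx n z\<bar> powr (- t / 2)"
    have "(\<integral>\<^sup>+z. ennreal (cf_density 0 z * cf_error n 0 z powr (- t / 2)) * indicator {0<..<1} z \<partial>lborel)
      \<le> ennreal (8 * exp U * ?R ^ n * exp (t * u 0))"
      by (rule cf_moment[where u = u]) (use u K t in auto)
    also have "\<dots> \<le> ennreal (?B * ?R' ^ n)"
    proof (rule ennreal_leI)
      have "\<bar>t * u 0\<bar> \<le> 1 * U" unfolding abs_mult using t u by (intro mult_mono) auto
      then have 1: "exp (t * u 0) \<le> exp U" by simp
      have 2: "?R ^ n \<le> ?R' ^ n" by (intro power_mono) (auto intro!: mult_left_mono)
      have "8 * exp U * ?R ^ n * exp (t * u 0) \<le> 8 * exp U * ?R' ^ n * exp U"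
        using 1 2 by (intro mult_mono) auto
      then show "8 * exp U * ?R ^ n * exp (t * u 0) \<le> ?B * ?R' ^ n" by (simp add: mult_ac)
    qed
    finally have int: "(\<integral>\<^sup>+z. ennreal (?h z) * indicator {0<..<1} z \<partial>lborel) \<le> ennreal (?B * ?R' ^ n)"
      by (simp add: cf_density_def cf_error_def)
    have "{z \<in> {0<..<1}. 1 \<le> \<eta> powr (t / 2) * ?h z} = {z \<in> {0<..<1}. 1 \<le> ennreal (\<eta> powr (t / 2)) * ennreal (?h z)}"
      by (auto simp: ennreal_mult[symmetric])
    then have "emeasure lborel {z \<in> {0<..<1}. 1 \<le> \<eta> powr (t / 2) * ?h z} \<le>
      ennreal (\<eta> powr (t / 2)) * (\<integral>\<^sup>+z. ennreal (?h z) * indicator {0<..<1} z \<partial>lborel)"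
      by (simp only:) (rule nn_integral_Markov_inequality; measurable)
    also have "\<dots> \<le> ennreal (\<eta> powr (t / 2)) * ennreal (?B * ?R' ^ n)"
      by (intro mult_left_mono int) auto
    also have "\<dots> = ennreal (\<eta> powr (t / 2) * (?B * ?R' ^ n))"
      by (subst ennreal_mult) auto
    finally show ?thesis .
  qed
  then have "\<forall>t n \<eta>. \<bar>t\<bar> \<le> 1 / 4 \<longrightarrow> \<eta> > 0 \<longrightarrow>
    emeasure lborel {z \<in> {0<..<1}. 1 \<le> \<eta> powr (t / 2) * \<bar>z - cf_approx n z\<bar> powr (- t / 2)}
      \<le> ennreal (\<eta> powr (t / 2) * (?B * exp (t * levy_const + \<bar>t\<bar> * \<epsilon> + t\<^sup>2 * \<bar>K\<bar>) ^ n))"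
    by blast
  moreover have "?B > 0" "\<bar>K\<bar> \<ge> 0" by auto
  ultimately show ?thesis by blast
qed

text \<open>The sign \<open>\<sigma>\<close> selects the tail: errors of size at most (\<open>1\<close>) or at least (\<open>-1\<close>) \<open>exp (- c n)\<close>.\<close>

lemma cf_approx_deviation:
  assumes "\<sigma> \<in> {-1, 1}" and gap: "\<sigma> * (c / 2 - levy_const) > 0"
  shows "\<exists>B>0. \<exists>\<gamma>>0. \<forall>n.
    emeasure lborel {z \<in> {0<..<1}. z \<noteq> cf_approx n z \<and>
       \<sigma> * ln \<bar>z - cf_approx n z\<bar> \<le> - \<sigma> * c * real n}
    \<le> ennreal (B * exp (- \<gamma> * real n))"
proof -
  \<comment> \<open>A quarter of the gap: one share is lost to the inexact mean, one to the
    quadratic term through \<open>\<tau> * K <= \<epsilon>\<close>, and two remain as decay rate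
    \<open>2 * \<tau> * \<epsilon>\<close>.\<close>
  define \<epsilon> where "\<epsilon> = \<sigma> * (c / 2 - levy_const) / 4"
  have \<epsilon>: "\<epsilon> > 0" using gap by (simp add: \<epsilon>_def)
  obtain B K where B: "B > 0" and K: "K \<ge> 0" and
    *: "\<And>t n \<eta>. \<bar>t\<bar> \<le> 1 / 4 \<Longrightarrow> \<eta> > 0 \<Longrightarrow>
    emeasure lborel {z \<in> {0<..<1}. 1 \<le> \<eta> powr (t / 2) * \<bar>z - cf_approx n z\<bar> powr (- t / 2)}
      \<le> ennreal (\<eta> powr (t / 2) * (B * exp (t * levy_const + \<bar>t\<bar> * \<epsilon> + t\<^sup>2 * K) ^ n))"
    using cf_approx_chebyshev[OF \<epsilon>] by blast
  define \<tau> where "\<tau> = min (1 / 4) (\<epsilon> / (K + 1))"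
  have \<tau>: "\<tau> \<le> 1 / 4" "\<tau> \<le> \<epsilon> / (K + 1)" unfolding \<tau>_def by (rule min.cobounded1 min.cobounded2)+
  have \<tau>0: "0 < \<tau>" using \<epsilon> K by (simp add: \<tau>_def)
  note \<tau> = \<tau> \<tau>0
  have "\<tau> * K \<le> \<epsilon> / (K + 1) * (K + 1)" using \<tau> K \<epsilon> by (intro mult_mono) auto
  then have \<tau>K: "\<tau> * K \<le> \<epsilon>" using K by simp
  define t where "t = \<sigma> * \<tau>"
  have t: "\<bar>t\<bar> = \<tau>" "t\<^sup>2 = \<tau> * \<tau>" using assms(1) \<tau> by (auto simp: t_def power2_eq_square)
  have "emeasure lborel {z \<in> {0<..<1}. z \<noteq> cf_approx n z \<and>
       \<sigma> * ln \<bar>z - cf_approx n z\<bar> \<le> - \<sigma> * c * real n}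
    \<le> ennreal (B * exp (- (2 * \<tau> * \<epsilon>) * real n))" for n
  proof -
    let ?\<eta> = "exp (- c * real n)"
    have "{z \<in> {0<..<1}. z \<noteq> cf_approx n z \<and> \<sigma> * ln \<bar>z - cf_approx n z\<bar> \<le> - \<sigma> * c * real n}
      \<subseteq> {z \<in> {0<..<1}. 1 \<le> ?\<eta> powr (t / 2) * \<bar>z - cf_approx n z\<bar> powr (- t / 2)}"
    proof safe
      \<comment> \<open>Since \<open>0 powr a = 0\<close>, points of zero error would escape the
        Markov event; they were excluded beforehand.\<close>
      fix z assume z: "z \<noteq> cf_approx n z" "\<sigma> * ln \<bar>z - cf_approx n z\<bar> \<le> - \<sigma> * c * real n"
      have "?\<eta> powr (t / 2) * \<bar>z - cf_approx n z\<bar> powr (- t / 2)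
        = exp (t / 2 * (- c * real n) + (- t / 2) * ln \<bar>z - cf_approx n z\<bar>)"
        using z(1) by (simp add: powr_def exp_add[symmetric])
      also have "t / 2 * (- c * real n) + (- t / 2) * ln \<bar>z - cf_approx n z\<bar>
         = \<tau> / 2 * (- \<sigma> * c * real n - \<sigma> * ln \<bar>z - cf_approx n z\<bar>)" by (simp add: t_def algebra_simps)
      finally show "1 \<le> ?\<eta> powr (t / 2) * \<bar>z - cf_approx n z\<bar> powr (- t / 2)"
        using z(2) \<tau> by simp
    qed
    then have "emeasure lborel {z \<in> {0<..<1}. z \<noteq> cf_approx n z \<and> \<sigma> * ln \<bar>z - cf_approx n z\<bar> \<le> - \<sigma> * c * real n}
      \<le> emeasure lborel {z \<in> {0<..<1}. 1 \<le> ?\<eta> powr (t / 2) * \<bar>z - cf_approx n z\<bar> powr (- t / 2)}"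
      by (rule emeasure_mono) measurable
    also have "\<dots> \<le> ennreal (?\<eta> powr (t / 2) * (B * exp (t * levy_const + \<bar>t\<bar> * \<epsilon> + t\<^sup>2 * K) ^ n))"
      by (rule *) (use t \<tau> in auto)
    also have "\<dots> \<le> ennreal (B * exp (- (2 * \<tau> * \<epsilon>) * real n))"
    proof (rule ennreal_leI)
      have "?\<eta> powr (t / 2) * (B * exp (t * levy_const + \<bar>t\<bar> * \<epsilon> + t\<^sup>2 * K) ^ n)
        = B * exp (real n * (- (t * (c / 2 - levy_const)) + \<tau> * \<epsilon> + \<tau> * (\<tau> * K)))"
        unfolding t by (simp add: powr_def exp_of_nat_mult[symmetric] exp_add[symmetric] algebra_simps)
      also have "t * (c / 2 - levy_const) = \<tau> * (4 * \<epsilon>)" by (simp add: t_def \<epsilon>_def)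
      also have "B * exp (real n * (- (\<tau> * (4 * \<epsilon>)) + \<tau> * \<epsilon> + \<tau> * (\<tau> * K))) \<le> B * exp (real n * (- (2 * \<tau> * \<epsilon>)))"
      proof -
        have "\<tau> * (\<tau> * K) \<le> \<tau> * \<epsilon>" using \<tau>K \<tau> by (intro mult_left_mono) auto
        then have "- (\<tau> * (4 * \<epsilon>)) + \<tau> * \<epsilon> + \<tau> * (\<tau> * K) \<le> - (2 * \<tau> * \<epsilon>)" by (simp add: mult.commute)
        then have "real n * (- (\<tau> * (4 * \<epsilon>)) + \<tau> * \<epsilon> + \<tau> * (\<tau> * K)) \<le> real n * (- (2 * \<tau> * \<epsilon>))"
          by (intro mult_left_mono) auto
        then show ?thesis using B by simp
      qed
      finally show "?\<eta> powr (t / 2) * (B * exp (t * levy_const + \<bar>t\<bar> * \<epsilon> + t\<^sup>2 * K) ^ n)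
          \<le> B * exp (- (2 * \<tau> * \<epsilon>) * real n)" by (simp add: mult.commute)
    qed
    finally show ?thesis .
  qed
  moreover have "2 * \<tau> * \<epsilon> > 0" using \<tau> \<epsilon> by simp
  ultimately show ?thesis using B by blast
qed

text \<open>\<open>emeasure_mono\<close> asks for measurability of the larger set, so it is enough
  to enclose the sets of the theorem in Borel sets.\<close>

lemma measure_lebesgue_le:
  assumes "S \<subseteq> A" "A \<in> sets borel" "emeasure lborel A \<le> ennreal b" "b \<ge> 0"
  shows "measure lebesgue S \<le> b"
proof -
  have "emeasure lebesgue S \<le> emeasure lebesgue A"
    using assms(1,2) by (intro emeasure_mono) auto
  also have "\<dots> = emeasure lborel A" using assms(2) by simp
  also note assms(3)
  finally show ?thesis using assms(4) unfolding measure_def by (simp add: enn2real_leI)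
qed

text \<open>Ensures that an irrational point never equals its convergent, so the logarithm of the
  error is meaningful.\<close>

lemma cf_approx_rational: "cf_approx n x \<in> \<rat>"
  unfolding of_rat_cf_value[symmetric] by simp

theorem theorem1p3:
  fixes \<beta> :: real
  assumes "\<beta> > 1"
  shows "(ln \<beta> > pi\<^sup>2 / (6 * ln 2) \<longrightarrow>
           (\<exists>B\<^sub>1 > 0. \<exists>\<gamma>\<^sub>1 > 0. \<forall>n \<ge> (1::nat).
             measure lebesgue {x \<in> {0..<1}. x \<notin> \<rat> \<and>
               \<bar>x - real_of_int (cf_num n x) / real_of_int (cf_denom n x)\<bar>
                 \<le> x - beta_convergent \<beta> n x}
             \<le> B\<^sub>1 * exp (- \<gamma>\<^sub>1 * real n)))
       \<and> (ln \<beta> < pi\<^sup>2 / (6 * ln 2) \<longrightarrow>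
           (\<exists>B\<^sub>2 > 0. \<exists>\<gamma>\<^sub>2 > 0. \<forall>n \<ge> (1::nat).
             measure lebesgue {x \<in> {0..<1}. x \<notin> \<rat> \<and>
               x - beta_convergent \<beta> n x
                 \<le> \<bar>x - real_of_int (cf_num n x) / real_of_int (cf_denom n x)\<bar>}
             \<le> B\<^sub>2 * exp (- \<gamma>\<^sub>2 * real n)))"
proof (intro conjI impI)
  have levy: "pi\<^sup>2 / (6 * ln 2) = 2 * levy_const" by (simp add: levy_const_def)
  have convergent: "real_of_int (cf_num n x) / real_of_int (cf_denom n x) = cf_approx n x" for n x
    by (simp add: cf_num_over_denom of_rat_cf_value)
  have remainder: "x - beta_convergent \<beta> n x = (beta_map \<beta> ^^ n) x * exp (- ln \<beta> * real n)" for n x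
  proof -
    have "exp (- ln \<beta> * real n) = 1 / \<beta> ^ n"
      using assms by (simp add: exp_minus exp_of_nat2_mult divide_inverse)
    then show ?thesis using beta_remainder[of \<beta> x n] assms by simp
  qed
  have irrational: "0 < x \<and> x \<noteq> cf_approx n x" if "x \<in> {0..<1}" "x \<notin> \<rat>" for x n
    using that cf_approx_rational[of n x] by (auto simp: less_le)
  {
    assume "ln \<beta> > pi\<^sup>2 / (6 * ln 2)"
    then have "1 * (ln \<beta> / 2 - levy_const) > 0" unfolding levy by simp
    from cf_approx_deviation[OF _ this] obtain B \<gamma> where B: "B > 0" "\<gamma> > 0" and
      dev: "\<And>n. emeasure lborel {z \<in> {0<..<1}. z \<noteq> cf_approx n z \<and> 1 * ln \<bar>z - cf_approx n z\<bar> \<le> - 1 * ln \<beta> * real n}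
        \<le> ennreal (B * exp (- \<gamma> * real n))" by auto
    have "measure lebesgue {x \<in> {0..<1}. x \<notin> \<rat> \<and>
        \<bar>x - real_of_int (cf_num n x) / real_of_int (cf_denom n x)\<bar> \<le> x - beta_convergent \<beta> n x}
        \<le> B * exp (- \<gamma> * real n)" for n
    proof (rule measure_lebesgue_le[OF _ _ dev])
      show "{x \<in> {0..<1}. x \<notin> \<rat> \<and>
        \<bar>x - real_of_int (cf_num n x) / real_of_int (cf_denom n x)\<bar> \<le> x - beta_convergent \<beta> n x} \<subseteq>
        {z \<in> {0<..<1}. z \<noteq> cf_approx n z \<and> 1 * ln \<bar>z - cf_approx n z\<bar> \<le> - 1 * ln \<beta> * real n}"
        unfolding convergent remainder
      proof
        fix x assume x: "x \<in> {x \<in> {0..<1}. x \<notin> \<rat> \<and> \<bar>x - cf_approx n x\<bar> \<le> (beta_map \<beta> ^^ n) x * exp (- ln \<beta> * real n)}"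
        \<comment> \<open>In (i) this trivial bound suffices: the error is then at most
          \<open>\<beta>^-n\<close>, a deviation because \<open>ln \<beta>\<close> exceeds
          \<open>2 * levy_const\<close>.\<close>
        have "(beta_map \<beta> ^^ n) x \<le> 1"
          using x beta_map_bounds[of \<beta> "(beta_map \<beta> ^^ (n - 1)) x"] by (cases n) auto
        then have "(beta_map \<beta> ^^ n) x * exp (- ln \<beta> * real n) \<le> 1 * exp (- ln \<beta> * real n)"
          by (intro mult_right_mono) auto
        moreover have "\<bar>x - cf_approx n x\<bar> \<le> (beta_map \<beta> ^^ n) x * exp (- ln \<beta> * real n)" using x by simp
        ultimately have le: "\<bar>x - cf_approx n x\<bar> \<le> exp (- ln \<beta> * real n)" by linarith
        have irr: "0 < x" "x \<noteq> cf_approx n x" using irrational[of x n] x by auto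
        have "ln \<bar>x - cf_approx n x\<bar> \<le> ln (exp (- ln \<beta> * real n))"
          using le irr by (intro ln_mono) auto
        then show "x \<in> {z \<in> {0<..<1}. z \<noteq> cf_approx n z \<and> 1 * ln \<bar>z - cf_approx n z\<bar> \<le> - 1 * ln \<beta> * real n}"
          using x irr by simp
      qed
    next
      show "{z \<in> {0<..<1}. z \<noteq> cf_approx n z \<and> 1 * ln \<bar>z - cf_approx n z\<bar> \<le> - 1 * ln \<beta> * real n} \<in> sets borel"
        by measurable
    qed (use B in simp)
    then show "\<exists>B\<^sub>1 > 0. \<exists>\<gamma>\<^sub>1 > 0. \<forall>n \<ge> (1::nat).
             measure lebesgue {x \<in> {0..<1}. x \<notin> \<rat> \<and>
               \<bar>x - real_of_int (cf_num n x) / real_of_int (cf_denom n x)\<bar>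
                 \<le> x - beta_convergent \<beta> n x}
             \<le> B\<^sub>1 * exp (- \<gamma>\<^sub>1 * real n)" using B by blast
  next
    assume gap: "ln \<beta> < pi\<^sup>2 / (6 * ln 2)"
    \<comment> \<open>\<open>ln \<beta>\<close> and \<open>2 * levy_const\<close> are
      \<open>2 * \<delta>\<close> apart, and \<open>c\<close> is their midpoint. Unless the iterate
      of \<open>beta_map\<close> is below \<open>exp (- \<delta> n)\<close>, the error is at least
      \<open>exp (- c n)\<close>; both events are exponentially rare.\<close>
    define \<delta> where "\<delta> = levy_const - ln \<beta> / 2"
    have \<delta>: "\<delta> > 0" using gap unfolding levy by (simp add: \<delta>_def)
    define c where "c = ln \<beta> + \<delta>"
    have "(-1) * (c / 2 - levy_const) > 0" using \<delta> by (simp add: c_def \<delta>_def)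
    from cf_approx_deviation[OF _ this] obtain B \<gamma> where B: "B > 0" "\<gamma> > 0" and
      dev: "\<And>n. emeasure lborel {z \<in> {0<..<1}. z \<noteq> cf_approx n z \<and> - 1 * ln \<bar>z - cf_approx n z\<bar> \<le> - (- 1) * c * real n}
        \<le> ennreal (B * exp (- \<gamma> * real n))" by auto
    define C where "C = \<beta> / (\<beta> - 1)"
    have C: "C > 0" using assms by (simp add: C_def)
    have "measure lebesgue {x \<in> {0..<1}. x \<notin> \<rat> \<and>
        x - beta_convergent \<beta> n x \<le> \<bar>x - real_of_int (cf_num n x) / real_of_int (cf_denom n x)\<bar>}
        \<le> (B + C) * exp (- (min \<gamma> \<delta>) * real n)" for n
    proof -
      let ?D = "{z \<in> {0<..<1}. z \<noteq> cf_approx n z \<and> - 1 * ln \<bar>z - cf_approx n z\<bar> \<le> - (- 1) * c * real n}"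
      let ?E = "{y \<in> {0..<1}. (beta_map \<beta> ^^ n) y < exp (- \<delta> * real n)}"
      show ?thesis
      proof (rule measure_lebesgue_le[where A = "?D \<union> ?E"])
        show "{x \<in> {0..<1}. x \<notin> \<rat> \<and>
            x - beta_convergent \<beta> n x \<le> \<bar>x - real_of_int (cf_num n x) / real_of_int (cf_denom n x)\<bar>} \<subseteq> ?D \<union> ?E"
          unfolding convergent remainder
        proof
          fix x assume x: "x \<in> {x \<in> {0..<1}. x \<notin> \<rat> \<and> (beta_map \<beta> ^^ n) x * exp (- ln \<beta> * real n) \<le> \<bar>x - cf_approx n x\<bar>}"
          have irr: "0 < x" "x \<noteq> cf_approx n x" using irrational[of x n] x by auto
          show "x \<in> ?D \<union> ?E"
          proof (cases "(beta_map \<beta> ^^ n) x < exp (- \<delta> * real n)")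
            case True
            then show ?thesis using x by auto
          next
            case False
            have "exp (- c * real n) = exp (- \<delta> * real n) * exp (- ln \<beta> * real n)"
              by (simp add: c_def exp_add[symmetric] algebra_simps)
            also have "\<dots> \<le> (beta_map \<beta> ^^ n) x * exp (- ln \<beta> * real n)"
              using False by (intro mult_right_mono) auto
            also have "\<dots> \<le> \<bar>x - cf_approx n x\<bar>" using x by simp
            finally have "ln (exp (- c * real n)) \<le> ln \<bar>x - cf_approx n x\<bar>" by (intro ln_mono) auto
            then show ?thesis using x irr by simp
          qed
        qed
        show "?D \<union> ?E \<in> sets borel" by measurable
        have "emeasure lborel (?D \<union> ?E) \<le> emeasure lborel ?D + emeasure lborel ?E"
          by (rule emeasure_subadditive) measurable
        also have "\<dots> \<le> ennreal (B * exp (- \<gamma> * real n)) + ennreal (C * exp (- \<delta> * real n))"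
          unfolding C_def by (intro add_mono dev emeasure_beta_map_less_unit assms) auto
        also have "\<dots> = ennreal (B * exp (- \<gamma> * real n) + C * exp (- \<delta> * real n))"
          using B C by (intro ennreal_plus[symmetric]) auto
        also have "\<dots> \<le> ennreal ((B + C) * exp (- (min \<gamma> \<delta>) * real n))"
        proof (rule ennreal_leI)
          have "exp (- \<gamma> * real n) \<le> exp (- (min \<gamma> \<delta>) * real n)" "exp (- \<delta> * real n) \<le> exp (- (min \<gamma> \<delta>) * real n)"
            by (auto intro!: mult_right_mono)
          then have "B * exp (- \<gamma> * real n) + C * exp (- \<delta> * real n) \<le>
              B * exp (- (min \<gamma> \<delta>) * real n) + C * exp (- (min \<gamma> \<delta>) * real n)"
            using B C by (intro add_mono mult_left_mono) auto
          then show "B * exp (- \<gamma> * real n) + C * exp (- \<delta> * real n) \<le> (B + C) * exp (- (min \<gamma> \<delta>) * real n)"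
            by (simp add: distrib_right)
        qed
        finally show "emeasure lborel (?D \<union> ?E) \<le> ennreal ((B + C) * exp (- (min \<gamma> \<delta>) * real n))" .
        show "0 \<le> (B + C) * exp (- (min \<gamma> \<delta>) * real n)" using B C by simp
      qed
    qed
    moreover have "B + C > 0" "min \<gamma> \<delta> > 0" using B C \<delta> by auto
    ultimately show "\<exists>B\<^sub>2 > 0. \<exists>\<gamma>\<^sub>2 > 0. \<forall>n \<ge> (1::nat).
             measure lebesgue {x \<in> {0..<1}. x \<notin> \<rat> \<and>
               x - beta_convergent \<beta> n x
                 \<le> \<bar>x - real_of_int (cf_num n x) / real_of_int (cf_denom n x)\<bar>}
             \<le> B\<^sub>2 * exp (- \<gamma>\<^sub>2 * real n)" by blast
  }
qed

end
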